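(* Consider the positive cross curvature flow on $\mathrm{SU}(2)$ for diagonal left-invariant metrics $g(t)=A(t)f^1\otimes f^1+B(t)f^2\otimes f^2+C(t)f^3\otimes f^3$, with any initial data $A_0\ge B_0\ge C_0>0$. Then: - If $A_0=B_0=C_0$, the solution exists for all time $t\ge0$ and $A(t)=B(t)=C(t)=\sqrt{A_0^2+4t}$. - If $A_0=B_0>C_0$, the solution exists for all time $t\ge 0$ and $\lim_{t\to\infty}C(t)=C_\infty\in(0,\infty)$. Moreover, as $t\to\infty$, $$A(t)=B(t)\sim(24C_\infty t)^{1/3},\qquad C(t)-C_\infty\sim-2^{-3}3^{-1/3}C_\infty^{5/3}t^{-1/3}.$$ - If $A_0>B_0\ge C_0$, there exists a finite time $T>0$ such that the (maximal) solution exists on $[0,T)$ and, as $t\to T$, $$A\sim\eta_1(T-t)^{-1/14},\quad B\sim\eta_2(T-t)^{3/14},\quad C\sim\eta_3(T-t)^{3/14},$$ for some finite positive constants $\eta_1,\eta_2,\eta_3$.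
   Context: Here $(f_i)$ is a left-invariant frame on $\mathrm{SU}(2)$ with $[f_i,f_j]=2f_k$ for $(i,j,k)$ cyclic, $(f^i)$ its dual. The positive cross curvature flow is $\partial_tg=2h$, where $h$ is the cross curvature tensor (diagonal in an orthonormal frame diagonalizing Ricci, with $h_{ii}=k_jk_l$, $k_i$ being the sectional curvature of the plane orthogonal to the $i$-th vector). It is equivalent to the ODE system, for positive functions $A,B,C$ with $(A,B,C)(0)=(A_0,B_0,C_0)$, $$\frac{dA}{dt}=\frac{2AYZ}{(ABC)^2},\quad\frac{dB}{dt}=\frac{2BZX}{(ABC)^2},\quad\frac{dC}{dt}=\frac{2CXY}{(ABC)^2},$$ $$X=3A^2-(B-C)^2-2AB-2AC,\quad Y=3B^2-(A-C)^2-2AB-2BC,\quad Z=3C^2-(A-B)^2-2BC-2AC.$$ The notation $u\sim v$ means $u/v\to1$. *)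

theory Defs
  imports "HOL-Analysis.Analysis" "HOL-Library.Landau_Symbols"
begin

text \<open>
  A left-invariant tensor on SU(2) is determined by its components in the left-invariant
  frame \<open>(f\<^sub>1, f\<^sub>2, f\<^sub>3)\<close>.  The vector \<open>x :: real^3\<close> stands for the left-invariant vector field
  \<open>x$1 f\<^sub>1 + x$2 f\<^sub>2 + x$3 f\<^sub>3\<close>; thus \<open>f\<^sub>i\<close> is \<open>axis i 1\<close>, the dual frame is \<open>f\<^sup>i x = x$i\<close>, and
  bilinear forms on \<open>real^3\<close> are the left-invariant (0,2)-tensors.  The group enters only
  through the bracket \<open>[f\<^sub>i, f\<^sub>j] = 2 f\<^sub>k\<close> for \<open>(i, j, k)\<close> cyclic.
\<close>

type_synonym form = "real^3 \<Rightarrow> real^3 \<Rightarrow> real"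

definition lie_bracket :: "real^3 \<Rightarrow> real^3 \<Rightarrow> real^3" where
  "lie_bracket x y = 2 *\<^sub>R cross3 x y"

lemma lie_bracket_frame:
  "lie_bracket (axis 1 1) (axis 2 1) = 2 *\<^sub>R axis 3 1"
  "lie_bracket (axis 2 1) (axis 3 1) = 2 *\<^sub>R axis 1 1"
  "lie_bracket (axis 3 1) (axis 1 1) = 2 *\<^sub>R axis 2 1"
  by (simp_all add: lie_bracket_def cross3_def vec_eq_iff forall_3 axis_def)

definition left_inv_metric :: "form \<Rightarrow> bool" where
  "left_inv_metric g \<longleftrightarrow>
     bilinear g \<and> (\<forall>x y. g x y = g y x) \<and> (\<forall>x. x \<noteq> 0 \<longrightarrow> g x x > 0)"

definition diag_metric :: "real \<Rightarrow> real \<Rightarrow> real \<Rightarrow> form" where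
  "diag_metric a b c x y = a * (x$1 * y$1) + b * (x$2 * y$2) + c * (x$3 * y$3)"

text \<open>
  The Levi-Civita connection of a left-invariant metric preserves left-invariant fields.  On
  those, metric compatibility has no term differentiating \<open>g y z\<close>, which is constant.
\<close>

definition levi_civita :: "form \<Rightarrow> real^3 \<Rightarrow> real^3 \<Rightarrow> real^3" where
  "levi_civita g = (THE D. bilinear D \<and>
     (\<forall>x y. D x y - D y x = lie_bracket x y) \<and>
     (\<forall>x y z. g (D x y) z + g y (D x z) = 0))"

definition riemann :: "form \<Rightarrow> real^3 \<Rightarrow> real^3 \<Rightarrow> real^3 \<Rightarrow> real^3" where
  "riemann g x y z =
     levi_civita g x (levi_civita g y z) - levi_civita g y (levi_civita g x z)
       - levi_civita g (lie_bracket x y) z"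

definition sectional :: "form \<Rightarrow> real^3 \<Rightarrow> real^3 \<Rightarrow> real" where
  "sectional g x y = g (riemann g x y y) x / (g x x * g y y - (g x y)\<^sup>2)"

definition ricci :: "form \<Rightarrow> form" where
  "ricci g y z = trace (matrix (\<lambda>x. riemann g x y z))"

definition ricci_frame :: "form \<Rightarrow> (3 \<Rightarrow> real^3) \<Rightarrow> bool" where
  "ricci_frame g e \<longleftrightarrow>
     (\<forall>i j. g (e i) (e j) = (if i = j then 1 else 0)) \<and>
     (\<forall>i j. i \<noteq> j \<longrightarrow> ricci g (e i) (e j) = 0)"

text \<open>
  The cross curvature tensor is diagonal in an orthonormal frame \<open>e\<close> diagonalizing Ricci, with
  \<open>h\<^sub>i\<^sub>i = k\<^sub>j k\<^sub>l\<close> for \<open>{i, j, l} = {1, 2, 3}\<close>.  The plane orthogonal to \<open>e j\<close> is spanned by \<open>e l\<close>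
  and \<open>e i\<close>, so \<open>k\<^sub>j = sectional g (e l) (e i)\<close>, and likewise \<open>k\<^sub>l = sectional g (e i) (e j)\<close>.
  The tensor does not depend on the choice of \<open>e\<close>.
\<close>

definition cross_curvature :: "form \<Rightarrow> form" where
  "cross_curvature g = (THE h. bilinear h \<and> (\<exists>e. ricci_frame g e \<and>
     (\<forall>i j. i \<noteq> j \<longrightarrow> h (e i) (e j) = 0) \<and>
     (\<forall>i j l. i \<noteq> j \<and> j \<noteq> l \<and> l \<noteq> i \<longrightarrow>
        h (e i) (e i) = sectional g (e l) (e i) * sectional g (e i) (e j))))"

definition positive_xcf_on :: "real set \<Rightarrow> (real \<Rightarrow> form) \<Rightarrow> bool" where
  "positive_xcf_on J g \<longleftrightarrow> (\<forall>t\<in>J. left_inv_metric (g t) \<and>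
     (\<forall>x y. ((\<lambda>s. g s x y) has_real_derivative 2 * cross_curvature (g t) x y) (at t within J)))"

definition time_interval :: "ereal \<Rightarrow> real set" where
  "time_interval T = {t. 0 \<le> t \<and> ereal t < T}"

definition diag_xcf_solution ::
  "real \<Rightarrow> real \<Rightarrow> real \<Rightarrow> ereal \<Rightarrow> (real \<Rightarrow> real) \<Rightarrow> (real \<Rightarrow> real) \<Rightarrow> (real \<Rightarrow> real) \<Rightarrow> bool"
where
  "diag_xcf_solution A0 B0 C0 T A B C \<longleftrightarrow>
     0 < T \<and> A 0 = A0 \<and> B 0 = B0 \<and> C 0 = C0 \<and>
     positive_xcf_on (time_interval T) (\<lambda>t. diag_metric (A t) (B t) (C t))"

text \<open>
  The maximal solution forward in time: every solution with the same initial data is a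
  restriction of it.  Uniqueness is thus part of the notion.
\<close>

definition maximal_diag_xcf_solution ::
  "real \<Rightarrow> real \<Rightarrow> real \<Rightarrow> ereal \<Rightarrow> (real \<Rightarrow> real) \<Rightarrow> (real \<Rightarrow> real) \<Rightarrow> (real \<Rightarrow> real) \<Rightarrow> bool"
where
  "maximal_diag_xcf_solution A0 B0 C0 T A B C \<longleftrightarrow>
     diag_xcf_solution A0 B0 C0 T A B C \<and>
     (\<forall>T' A' B' C'. diag_xcf_solution A0 B0 C0 T' A' B' C' \<longrightarrow>
        T' \<le> T \<and> (\<forall>t\<in>time_interval T'. A' t = A t \<and> B' t = B t \<and> C' t = C t))"

end

theory Submission
  imports Defs
begin

text \<open>
  On a diagonal metric the flow is an ODE for \<open>(A, B, C)\<close>.  With the ratios \<open>u = B/A\<close>, \<open>v = C/A\<close> and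
  the time \<open>s\<close> defined by \<open>dt = A\<^sup>2 u\<^sup>2 v\<^sup>2 / 2 ds\<close>, homogeneity decouples a polynomial system for
  \<open>(u, v)\<close>; it preserves the triangle \<open>0 < v \<le> u \<le> 1\<close>, so its solutions exist for all \<open>s \<ge> 0\<close>, and
  \<open>(log A)'\<close> is a polynomial in \<open>u, v\<close>.  The lifetime of the flow is the limit of \<open>t(s)\<close>.  If
  \<open>A = B > C\<close>, then \<open>u = 1\<close>, \<open>v\<close> decreases to \<open>0\<close>, \<open>C\<^sup>4 / (1 - v)\<close> is conserved and
  \<open>t v\<^sup>3\<close> tends to \<open>C\<^sub>\<infinity>\<^sup>2 / 24\<close>.  If \<open>A > B\<close>, then \<open>u\<close> and \<open>v\<close> tend to \<open>0\<close>, where the system is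
  asymptotically \<open>u' = - 4 u\<close>, \<open>v' = - 4 v\<close>, \<open>A' = A\<close>; hence \<open>A\<close> is asymptotic to a multiple of
  \<open>e\<^sup>s\<close>, \<open>B\<close> and \<open>C\<close> to multiples of \<open>e\<^bsup>-3s\<^esup>\<close>, and \<open>T - t\<close> to a multiple of \<open>e\<^bsup>-14s\<^esup>\<close>.
\<close>

text \<open>The exponents come from a count of rates. The density of \<open>t\<close> with respect
  to \<open>s\<close> has rate 2 - 8 - 8 = -14, so up to a convergent term \<open>s\<close> is -1/14
  times the logarithm of \<open>T - t\<close>; the rates 1 of \<open>A\<close> and -3 of
  \<open>B\<close>, \<open>C\<close> become the exponents -1/14 and 3/14. The limiting constants
  exist because the error of the linearization is bounded by a multiple of \<open>u\<close>, which
  is integrable over all \<open>s\<close>. On the edge \<open>u = 1\<close> the linearization in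
  \<open>v\<close> vanishes at 0, so the decay is only algebraic: this is the source of the cube
  roots. There the conserved quantity gives both the limit of \<open>C\<close> and its first
  correction. The corner \<open>u = v = 1\<close> is an equilibrium, and the round solution is
  checked from its formula. Two obstacles lie outside the asymptotics. Frames diagonalizing Ricci
  are far from unique when eigenvalues coincide, so a tensor defined by \<open>THE\<close> has to be
  expressed without a frame. And maximality compares with every solution of the original singular
  system, so uniqueness is proved for \<open>(A, B, C)\<close> and not for the ratios.\<close>

section \<open>Cross curvature of diagonal metrics\<close>

text \<open>
  For the metric with coefficients \<open>a, b, c\<close> this is the sectional curvature of the plane spanned by
  the second and third frame vectors, i.e. \<open>- X / (A B C)\<close> in the notation of the ODE system.
\<close>

definition milnor_curv :: "real \<Rightarrow> real \<Rightarrow> real \<Rightarrow> real" where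
  "milnor_curv a b c = ((b - c)\<^sup>2 + 2*a*b + 2*a*c - 3*a\<^sup>2) / (a*b*c)"

section \<open>Levi-Civita connection and curvature of a diagonal metric\<close>

definition diag_connection :: "real \<Rightarrow> real \<Rightarrow> real \<Rightarrow> real^3 \<Rightarrow> real^3 \<Rightarrow> real^3" where
  "diag_connection a b c x y = vector
     [((c + a - b) * x$2 * y$3 + (c - b - a) * x$3 * y$2) / a,
      ((a + b - c) * x$3 * y$1 + (a - c - b) * x$1 * y$3) / b,
      ((b + c - a) * x$1 * y$2 + (b - a - c) * x$2 * y$1) / c]"

lemma left_inv_metric_diag:
  assumes "left_inv_metric (diag_metric a b c)"
  shows "a > 0" "b > 0" "c > 0"
proof -
  have *: "x \<noteq> 0 \<Longrightarrow> diag_metric a b c x x > 0" for x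
    using assms by (auto simp: left_inv_metric_def)
  show "a > 0" using *[of "axis 1 1"] by (simp add: diag_metric_def axis_def vec_eq_iff)
  show "b > 0" using *[of "axis 2 1"] by (simp add: diag_metric_def axis_def vec_eq_iff)
  show "c > 0" using *[of "axis 3 1"] by (simp add: diag_metric_def axis_def vec_eq_iff)
qed

lemma bilinear_diag_metric: "bilinear (diag_metric a b c)"
  by (auto simp: bilinear_def diag_metric_def algebra_simps intro!: linearI)

lemma diag_metric_commute: "diag_metric a b c x y = diag_metric a b c y x"
  by (simp add: diag_metric_def algebra_simps)

lemma diag_metric_left_inv:
  assumes "a > 0" "b > 0" "c > 0"
  shows "left_inv_metric (diag_metric a b c)"
proof -
  have "diag_metric a b c x x > 0" if "x \<noteq> 0" for x
  proof -
    from that obtain i where "x $ i \<noteq> 0" by (auto simp: vec_eq_iff)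
    then have "x$1 \<noteq> 0 \<or> x$2 \<noteq> 0 \<or> x$3 \<noteq> 0" using exhaust_3[of i] by auto
    moreover have "r * (y * y) \<ge> 0" "y \<noteq> 0 \<Longrightarrow> r * (y * y) > 0" if "r > 0" for r y :: real
      using that by (auto simp: zero_less_mult_iff)
    ultimately show ?thesis
      unfolding diag_metric_def using assms
      by (smt (verit, best))
  qed
  then show ?thesis
    by (auto simp: left_inv_metric_def bilinear_diag_metric diag_metric_commute)
qed

lemma bilinear_diag_connection: "bilinear (diag_connection a b c)"
  by (auto simp: bilinear_def diag_connection_def vec_eq_iff forall_3 algebra_simps
      add_divide_distrib diff_divide_distrib intro!: linearI)

text \<open>The Koszul identity determines a torsion-free metric connection. For left-invariant
  fields its derivative terms vanish, so bracket and metric coefficients alone fix every component,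
  and \<open>diag_connection\<close> is the result.\<close>

lemma levi_civita_diag:
  assumes "a > 0" "b > 0" "c > 0"
  shows "levi_civita (diag_metric a b c) = diag_connection a b c"
  unfolding levi_civita_def
proof (rule the_equality, intro conjI allI)
  show "bilinear (diag_connection a b c)" by (rule bilinear_diag_connection)
  show "diag_connection a b c x y - diag_connection a b c y x = lie_bracket x y" for x y
    using assms
    by (simp add: diag_connection_def lie_bracket_def cross3_def vec_eq_iff forall_3 field_simps)
  show "diag_metric a b c (diag_connection a b c x y) z
      + diag_metric a b c y (diag_connection a b c x z) = 0" for x y z
    using assms by (simp add: diag_connection_def diag_metric_def field_simps)
next
  fix D assume D: "bilinear D \<and> (\<forall>x y. D x y - D y x = lie_bracket x y) \<and>
     (\<forall>x y z. diag_metric a b c (D x y) z + diag_metric a b c y (D x z) = 0)"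
  let ?g = "diag_metric a b c"
  have add: "?g (x - y) z = ?g x z - ?g y z" "?g z (x - y) = ?g z x - ?g z y" for x y z
    by (simp_all add: diag_metric_def algebra_simps)
  have comp: "?g (D x y) z = - ?g (D x z) y" for x y z
    using D by (metis add_eq_0_iff diag_metric_commute)
  have tor: "?g (D x y) z = ?g (D y x) z + ?g (lie_bracket x y) z" for x y z
  proof -
    have "?g (D x y - D y x) z = ?g (lie_bracket x y) z" using D by metis
    then show ?thesis unfolding add by simp
  qed
  \<comment> \<open>Torsion-freeness for the three cyclic orders of the arguments, combined with
    skewness of each \<open>D x\<close>, eliminates all connection terms but one.\<close>
  have koszul: "2 * ?g (D x y) z
      = ?g (lie_bracket x y) z - ?g (lie_bracket y z) x + ?g (lie_bracket z x) y" for x y z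
    using comp[of x y z] comp[of y z x] comp[of z x y] tor[of x y z] tor[of y z x] tor[of z x y]
    by simp
  show "D = diag_connection a b c"
  proof (intro ext)
    fix x y
    have "2 * (a * D x y $ 1) = 2 * ((c + a - b) * x$2 * y$3 + (c - b - a) * x$3 * y$2)"
      using koszul[of x y "axis 1 1"]
      by (simp add: diag_metric_def lie_bracket_def cross3_def axis_def algebra_simps)
    moreover have "2 * (b * D x y $ 2) = 2 * ((a + b - c) * x$3 * y$1 + (a - c - b) * x$1 * y$3)"
      using koszul[of x y "axis 2 1"]
      by (simp add: diag_metric_def lie_bracket_def cross3_def axis_def algebra_simps)
    moreover have "2 * (c * D x y $ 3) = 2 * ((b + c - a) * x$1 * y$2 + (b - a - c) * x$2 * y$1)"
      using koszul[of x y "axis 3 1"]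
      by (simp add: diag_metric_def lie_bracket_def cross3_def axis_def algebra_simps)
    ultimately show "D x y = diag_connection a b c x y"
      using assms
      by (simp add: vec_eq_iff forall_3 diag_connection_def eq_divide_eq mult.commute)
  qed
qed

text \<open>The cross product identifies planes with vectors, and the curvature operator is then
  diagonal: each component of \<open>w\<close> is weighted by the curvature of the coordinate plane
  orthogonal to that axis and contributes an infinitesimal rotation of this plane.\<close>

lemma riemann_diag:
  assumes "a > 0" "b > 0" "c > 0"
  defines "k1 \<equiv> milnor_curv a b c" and "k2 \<equiv> milnor_curv b c a" and "k3 \<equiv> milnor_curv c a b"
  shows "riemann (diag_metric a b c) x y z =
    (let w = cross3 x y in vector
      [k3 * b * w$3 * z$2 - k2 * c * w$2 * z$3,
       k1 * c * w$1 * z$3 - k3 * a * w$3 * z$1,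
       k2 * a * w$2 * z$1 - k1 * b * w$1 * z$2])"
proof -
  have n: "a \<noteq> 0" "b \<noteq> 0" "c \<noteq> 0" using assms by auto
  show ?thesis
    unfolding riemann_def levi_civita_diag[OF assms(1-3)]
    apply (simp add: vec_eq_iff forall_3 Let_def diag_connection_def lie_bracket_def cross3_def
       k1_def k2_def k3_def milnor_curv_def)
    apply (intro conjI)
    using n apply (simp_all add: divide_simps)
    apply (simp_all add: power2_eq_square)
    apply algebra+
    done
qed

lemma ricci_diag:
  assumes "a > 0" "b > 0" "c > 0"
  defines "k1 \<equiv> milnor_curv a b c" and "k2 \<equiv> milnor_curv b c a" and "k3 \<equiv> milnor_curv c a b"
  shows "ricci (diag_metric a b c) = diag_metric (a * (k2 + k3)) (b * (k3 + k1)) (c * (k1 + k2))"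
proof (intro ext)
  fix y z
  show "ricci (diag_metric a b c) y z
      = diag_metric (a * (k2 + k3)) (b * (k3 + k1)) (c * (k1 + k2)) y z"
    unfolding ricci_def riemann_diag[OF assms(1-3)] Let_def k1_def k2_def k3_def
    by (simp add: trace_def sum_3 matrix_def cross3_def axis_def diag_metric_def algebra_simps)
qed

section \<open>Orthonormal frames and the cross curvature tensor\<close>

lemma diag_orthonormal_completeness:
  fixes e :: "3 \<Rightarrow> real^3" and w :: "3 \<Rightarrow> real"
  assumes "\<And>i j. (\<Sum>m\<in>UNIV. w m * (e i $ m * e j $ m)) = (if i = j then 1 else 0)"
  shows "(\<Sum>i\<in>UNIV. w m * (e i $ m * e i $ n)) = (if m = n then 1 else 0)"
proof -
  define M :: "real^3^3" where "M = (\<chi> i m. e i $ m)"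
  define N :: "real^3^3" where "N = (\<chi> m i. w m * e i $ m)"
  have "M ** N = mat 1"
    using assms by (simp add: M_def N_def matrix_matrix_mult_def mat_def vec_eq_iff mult.left_commute)
  \<comment> \<open>A right inverse of a square matrix is a left inverse, so orthonormality of the
    rows becomes a completeness relation for the columns.\<close>
  then have "N ** M = mat 1" by (simp add: matrix_left_right_inverse)
  then have "(N ** M) $ m $ n = (if m = n then 1 else 0)" by (simp add: mat_def)
  then show ?thesis by (simp add: M_def N_def matrix_matrix_mult_def mult.assoc)
qed

lemma diag_metric_completeness:
  fixes e :: "3 \<Rightarrow> real^3"
  assumes "\<And>i j. diag_metric a b c (e i) (e j) = (if i = j then 1 else 0)"
  shows "a * ((e 1 $ 1)\<^sup>2 + (e 2 $ 1)\<^sup>2 + (e 3 $ 1)\<^sup>2) = 1"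
    "b * ((e 1 $ 2)\<^sup>2 + (e 2 $ 2)\<^sup>2 + (e 3 $ 2)\<^sup>2) = 1"
    "c * ((e 1 $ 3)\<^sup>2 + (e 2 $ 3)\<^sup>2 + (e 3 $ 3)\<^sup>2) = 1"
    "m \<noteq> n \<Longrightarrow> e 1 $ m * e 1 $ n + e 2 $ m * e 2 $ n + e 3 $ m * e 3 $ n = 0"
proof -
  define w :: "3 \<Rightarrow> real" where "w m = (if m = 1 then a else if m = 2 then b else c)" for m
  have o: "(\<Sum>m\<in>UNIV. w m * (e i $ m * e j $ m)) = (if i = j then 1 else 0)" for i j
    using assms[of i j] by (simp add: sum_3 w_def diag_metric_def)
  have C: "w m * (e 1 $ m * e 1 $ n + e 2 $ m * e 2 $ n + e 3 $ m * e 3 $ n)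
      = (if m = n then 1 else 0)" for m n
    using diag_orthonormal_completeness[of w e, OF o] by (simp add: sum_3 distrib_left)
  show "a * ((e 1 $ 1)\<^sup>2 + (e 2 $ 1)\<^sup>2 + (e 3 $ 1)\<^sup>2) = 1"
    "b * ((e 1 $ 2)\<^sup>2 + (e 2 $ 2)\<^sup>2 + (e 3 $ 2)\<^sup>2) = 1"
    "c * ((e 1 $ 3)\<^sup>2 + (e 2 $ 3)\<^sup>2 + (e 3 $ 3)\<^sup>2) = 1"
    using C[of 1 1] C[of 2 2] C[of 3 3] by (simp_all add: w_def power2_eq_square)
  show "e 1 $ m * e 1 $ n + e 2 $ m * e 2 $ n + e 3 $ m * e 3 $ n = 0" if "m \<noteq> n"
    using C[of m n] C[of m m] that by auto
qed

lemma sum_3_cyclic: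
  fixes i j l :: 3
  assumes "i \<noteq> j" "j \<noteq> l" "l \<noteq> i"
  shows "f i + f j + f l = f 1 + f 2 + (f 3 :: real)"
  using assms exhaust_3[of i] exhaust_3[of j] exhaust_3[of l] by auto

text \<open>Up to sign and coordinatewise rescaling by the metric, the cross product of two members
  of an orthonormal frame is the third one. The curvature of their plane is therefore a diagonal
  quadratic form evaluated at the normal vector.\<close>

lemma sectional_diag:
  fixes e :: "3 \<Rightarrow> real^3"
  assumes pos: "a > 0" "b > 0" "c > 0"
  assumes o: "\<And>i j. diag_metric a b c (e i) (e j) = (if i = j then 1 else 0)"
  assumes d: "i \<noteq> j" "j \<noteq> l" "l \<noteq> i"
  defines "k1 \<equiv> milnor_curv a b c" and "k2 \<equiv> milnor_curv b c a" and "k3 \<equiv> milnor_curv c a b"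
  shows "sectional (diag_metric a b c) (e i) (e j) = diag_metric (a*k1) (b*k2) (c*k3) (e l) (e l)"
proof -
  let ?x = "e i" and ?y = "e j" and ?z = "e l"
  have o1: "a * (?x$1)\<^sup>2 + b * (?x$2)\<^sup>2 + c * (?x$3)\<^sup>2 = 1"
    and o2: "a * (?y$1)\<^sup>2 + b * (?y$2)\<^sup>2 + c * (?y$3)\<^sup>2 = 1"
    and o3: "a * (?x$1 * ?y$1) + b * (?x$2 * ?y$2) + c * (?x$3 * ?y$3) = 0"
    using o[of i i] o[of j j] o[of i j] d by (simp_all add: diag_metric_def power2_eq_square)
  have c1: "a * ((?x$1)\<^sup>2 + (?y$1)\<^sup>2 + (?z$1)\<^sup>2) = 1"
    and c2: "b * ((?x$2)\<^sup>2 + (?y$2)\<^sup>2 + (?z$2)\<^sup>2) = 1"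
    and c3: "c * ((?x$3)\<^sup>2 + (?y$3)\<^sup>2 + (?z$3)\<^sup>2) = 1"
    using diag_metric_completeness(1-3)[of a b c e, OF o]
      sum_3_cyclic[OF d, of "\<lambda>i. (e i $ 1)\<^sup>2"] sum_3_cyclic[OF d, of "\<lambda>i. (e i $ 2)\<^sup>2"]
      sum_3_cyclic[OF d, of "\<lambda>i. (e i $ 3)\<^sup>2"] by simp_all
  \<comment> \<open>Squares remove the sign that depends on the orientation of the frame.\<close>
  have n: "b * c * (?x$2 * ?y$3 - ?x$3 * ?y$2)\<^sup>2 = a * (?z$1)\<^sup>2"
    "a * c * (?x$3 * ?y$1 - ?x$1 * ?y$3)\<^sup>2 = b * (?z$2)\<^sup>2"
    "a * b * (?x$1 * ?y$2 - ?x$2 * ?y$1)\<^sup>2 = c * (?z$3)\<^sup>2"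
    using o1 o2 o3 c1 c2 c3 by algebra+
  have "sectional (diag_metric a b c) ?x ?y
      = diag_metric a b c (riemann (diag_metric a b c) ?x ?y ?y) ?x"
    using d by (simp add: sectional_def o)
  also have "\<dots> = k1 * (b * c * (?x$2 * ?y$3 - ?x$3 * ?y$2)\<^sup>2)
     + k2 * (a * c * (?x$3 * ?y$1 - ?x$1 * ?y$3)\<^sup>2) + k3 * (a * b * (?x$1 * ?y$2 - ?x$2 * ?y$1)\<^sup>2)"
    unfolding riemann_diag[OF pos] Let_def diag_metric_def k1_def k2_def k3_def
    by (simp add: cross3_def power2_eq_square algebra_simps)
  also have "\<dots> = diag_metric (a*k1) (b*k2) (c*k3) ?z ?z"
    unfolding n by (simp add: diag_metric_def power2_eq_square)
  finally show ?thesis .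
qed

lemma form_eq_on_frame:
  fixes e :: "3 \<Rightarrow> real^3" and h H :: form
  assumes o: "\<And>i j. diag_metric a b c (e i) (e j) = (if i = j then 1 else 0)"
    and h: "bilinear h" and H: "bilinear H" and eq: "\<And>i j. h (e i) (e j) = H (e i) (e j)"
  shows "h = H"
proof (intro ext)
  let ?g = "diag_metric a b c"
  have ex: "x = ?g x (e 1) *\<^sub>R e 1 + ?g x (e 2) *\<^sub>R e 2 + ?g x (e 3) *\<^sub>R e 3" for x
    unfolding vec_eq_iff forall_3 diag_metric_def
    using diag_metric_completeness(1-3)[of a b c e, OF o]
      diag_metric_completeness(4)[of a b c e 1 2, OF o] diag_metric_completeness(4)[of a b c e 1 3, OF o]
      diag_metric_completeness(4)[of a b c e 2 3, OF o]
    by simp algebra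
  fix x y
  have *: "k x y = (\<Sum>i\<in>UNIV. \<Sum>j\<in>UNIV. ?g x (e i) * (?g y (e j) * k (e i) (e j)))"
    if "bilinear k" for k :: form
    by (subst (1) ex[of x], subst (1) ex[of y])
      (simp add: sum_3 bilinear_ladd[OF that] bilinear_radd[OF that] bilinear_lmul[OF that]
        bilinear_rmul[OF that] algebra_simps)
  show "h x y = H x y" unfolding *[OF h] *[OF H] eq ..
qed

text \<open>
  The tensor \<open>K = \<tau> g - Ric\<close>, with \<open>\<tau>\<close> half the scalar curvature, is diagonal in every
  admissible frame, with the curvatures of the orthogonal planes as entries.  The cross curvature
  tensor is its adjugate, and Cayley-Hamilton writes the adjugate in terms of \<open>K\<close> alone; this makes
  it independent of the frame.
\<close>

lemma cross_curvature_diag: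
  assumes pos: "a > 0" "b > 0" "c > 0"
  defines "k1 \<equiv> milnor_curv a b c" and "k2 \<equiv> milnor_curv b c a" and "k3 \<equiv> milnor_curv c a b"
  shows "cross_curvature (diag_metric a b c)
    = diag_metric (a * (k2 * k3)) (b * (k3 * k1)) (c * (k1 * k2))"
proof -
  let ?g = "diag_metric a b c" and ?K = "diag_metric (a*k1) (b*k2) (c*k3)"
  let ?H = "diag_metric (a * (k2 * k3)) (b * (k3 * k1)) (c * (k1 * k2))"
  have H: "?H (e i) (e j) = 0" "i \<noteq> j \<Longrightarrow> j \<noteq> l \<Longrightarrow> l \<noteq> i \<Longrightarrow>
       ?H (e i) (e i) = sectional ?g (e l) (e i) * sectional ?g (e i) (e j)"
    if e: "ricci_frame ?g e" and ij: "i \<noteq> j" for e and i j l :: 3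
  proof -
    have o: "\<And>i j. ?g (e i) (e j) = (if i = j then 1 else 0)"
      and r: "\<And>i j. i \<noteq> j \<Longrightarrow> ricci ?g (e i) (e j) = 0"
      using e by (auto simp: ricci_frame_def)
    note c = diag_metric_completeness(1-3)[of a b c e, OF o]
      diag_metric_completeness(4)[of a b c e 1 2, OF o] diag_metric_completeness(4)[of a b c e 1 3, OF o]
      diag_metric_completeness(4)[of a b c e 2 3, OF o]
    have K: "?K (e i) (e j) = 0" if "i \<noteq> j" for i j
    proof -
      have "ricci ?g (e i) (e j) + ?K (e i) (e j) = (k1 + k2 + k3) * ?g (e i) (e j)"
        unfolding ricci_diag[OF pos] diag_metric_def k1_def k2_def k3_def
        by (simp add: algebra_simps)
      then show ?thesis using o r that by simp
    qed
    define \<kappa> where "\<kappa> i = ?K (e i) (e i)" for i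
    have Ke: "?K (e i) (e j) = (if i = j then \<kappa> i else 0)" for i j
      using K by (simp add: \<kappa>_def)
    \<comment> \<open>The completeness relation composes two copies of \<open>?K\<close>. Relative
      to the metric its eigenvalues are \<open>k1\<close>, \<open>k2\<close>, \<open>k3\<close>,
      which is why the composition carries weights such as \<open>a*k1\<^sup>2\<close>.\<close>
    have K2: "diag_metric (a*k1\<^sup>2) (b*k2\<^sup>2) (c*k3\<^sup>2) (e i) (e j) = (if i = j then (\<kappa> i)\<^sup>2 else 0)" for i j
    proof -
      have "diag_metric (a*k1\<^sup>2) (b*k2\<^sup>2) (c*k3\<^sup>2) x y
          = ?K x (e 1) * ?K (e 1) y + ?K x (e 2) * ?K (e 2) y + ?K x (e 3) * ?K (e 3) y" for x y
        unfolding diag_metric_def using c by simp algebra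
      then show ?thesis using exhaust_3[of i] exhaust_3[of j] by (auto simp: Ke power2_eq_square)
    qed
    have t1: "k1 + k2 + k3 = \<kappa> 1 + \<kappa> 2 + \<kappa> 3"
      unfolding \<kappa>_def diag_metric_def using c(1-3) by algebra
    have t2: "k1\<^sup>2 + k2\<^sup>2 + k3\<^sup>2 = (\<kappa> 1)\<^sup>2 + (\<kappa> 2)\<^sup>2 + (\<kappa> 3)\<^sup>2"
      using K2[of 1 1] K2[of 2 2] K2[of 3 3] c(1-3) unfolding diag_metric_def by simp algebra
    \<comment> \<open>On eigenvalues this reads \<open>x\<^sup>2 - (x + y + z) * x + (x * y + y * z
      + z * x) = y * z\<close>. The coefficients are power sums, and \<open>t1\<close>,
      \<open>t2\<close> identify them with those of the frame \<open>e\<close>.\<close>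
    have cayley_hamilton: "?H x y = diag_metric (a*k1\<^sup>2) (b*k2\<^sup>2) (c*k3\<^sup>2) x y - (k1+k2+k3) * ?K x y
        + ((k1+k2+k3)\<^sup>2 - (k1\<^sup>2 + k2\<^sup>2 + k3\<^sup>2)) / 2 * ?g x y" for x y
      unfolding diag_metric_def by (simp add: power2_eq_square field_simps)
    show "?H (e i) (e j) = 0"
      unfolding cayley_hamilton using ij by (simp add: K2 Ke o)
    show "?H (e i) (e i) = sectional ?g (e l) (e i) * sectional ?g (e i) (e j)"
      if d: "i \<noteq> j" "j \<noteq> l" "l \<noteq> i"
    proof -
      have s: "sectional ?g (e l) (e i) = \<kappa> j" "sectional ?g (e i) (e j) = \<kappa> l"
        using sectional_diag[OF pos o, of l i j] sectional_diag[OF pos o, of i j l] d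
        by (auto simp: \<kappa>_def k1_def k2_def k3_def)
      have "k1 + k2 + k3 = \<kappa> i + \<kappa> j + \<kappa> l" "k1\<^sup>2 + k2\<^sup>2 + k3\<^sup>2 = (\<kappa> i)\<^sup>2 + (\<kappa> j)\<^sup>2 + (\<kappa> l)\<^sup>2"
        using sum_3_cyclic[OF d, of \<kappa>] sum_3_cyclic[OF d, of "\<lambda>i. (\<kappa> i)\<^sup>2"] t1 t2 by simp_all
      then show ?thesis
        unfolding cayley_hamilton s K2 Ke o by (simp add: power2_eq_square field_simps)
    qed
  qed
  \<comment> \<open>Ricci is diagonal in the normalized coordinate frame, so an admissible frame
    exists.\<close>
  define e0 where "e0 i = axis i (1 / sqrt (if i = 1 then a else if i = 2 then b else c))" for i :: 3
  have e0: "ricci_frame ?g e0"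
    unfolding ricci_frame_def ricci_diag[OF pos] forall_3 diag_metric_def e0_def axis_def
    using pos by simp
  show ?thesis
    unfolding cross_curvature_def
  proof (rule the_equality)
    show "bilinear ?H \<and> (\<exists>e. ricci_frame ?g e \<and> (\<forall>i j. i \<noteq> j \<longrightarrow> ?H (e i) (e j) = 0) \<and>
     (\<forall>i j l. i \<noteq> j \<and> j \<noteq> l \<and> l \<noteq> i \<longrightarrow>
        ?H (e i) (e i) = sectional ?g (e l) (e i) * sectional ?g (e i) (e j)))"
    proof (intro conjI exI[of _ e0] allI impI)
      show "?H (e0 i) (e0 i) = sectional ?g (e0 l) (e0 i) * sectional ?g (e0 i) (e0 j)"
        if "i \<noteq> j \<and> j \<noteq> l \<and> l \<noteq> i" for i j l
        using H(2)[OF e0, of i j l] that by simp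
    qed (use H(1)[OF e0] e0 bilinear_diag_metric in simp_all)
  next
    fix h assume "bilinear h \<and> (\<exists>e. ricci_frame ?g e \<and> (\<forall>i j. i \<noteq> j \<longrightarrow> h (e i) (e j) = 0) \<and>
     (\<forall>i j l. i \<noteq> j \<and> j \<noteq> l \<and> l \<noteq> i \<longrightarrow>
        h (e i) (e i) = sectional ?g (e l) (e i) * sectional ?g (e i) (e j)))"
    then obtain e where h: "bilinear h" and e: "ricci_frame ?g e"
      and off: "\<forall>i j. i \<noteq> j \<longrightarrow> h (e i) (e j) = 0"
      and on: "\<forall>i j l. i \<noteq> j \<and> j \<noteq> l \<and> l \<noteq> i \<longrightarrow>
        h (e i) (e i) = sectional ?g (e l) (e i) * sectional ?g (e i) (e j)"
      by (elim conjE exE) (rule that)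
    have "h (e i) (e j) = ?H (e i) (e j)" for i j
    proof (cases "i = j")
      case True
      consider "i = 1" | "i = 2" | "i = 3" using exhaust_3 by blast
      then obtain j' l where "i \<noteq> j'" "j' \<noteq> l" "l \<noteq> i"
        by cases (use that[of 2 3] that[of 3 1] that[of 1 2] in simp_all)
      then show ?thesis using H(2)[OF e, of i j' l] on[rule_format, of i j' l] True by simp
    qed (use H(1)[OF e] off in simp)
    moreover have "?g (e i) (e j) = (if i = j then 1 else 0)" for i j
      using e by (simp add: ricci_frame_def)
    ultimately show "h = ?H"
      by (intro form_eq_on_frame[OF _ h bilinear_diag_metric])
  qed
qed

section \<open>Reduction of the flow to three scalar equations\<close>

lemma positive_xcf_on_diag:
  "positive_xcf_on J (\<lambda>t. diag_metric (A t) (B t) (C t)) \<longleftrightarrow>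
    (\<forall>t\<in>J. A t > 0 \<and> B t > 0 \<and> C t > 0 \<and>
      (A has_real_derivative
        2 * (A t * (milnor_curv (B t) (C t) (A t) * milnor_curv (C t) (A t) (B t)))) (at t within J) \<and>
      (B has_real_derivative
        2 * (B t * (milnor_curv (C t) (A t) (B t) * milnor_curv (A t) (B t) (C t)))) (at t within J) \<and>
      (C has_real_derivative
        2 * (C t * (milnor_curv (A t) (B t) (C t) * milnor_curv (B t) (C t) (A t)))) (at t within J))"
  (is "_ = (\<forall>t\<in>J. ?P t)")
  unfolding positive_xcf_on_def
proof (intro ball_cong refl iffI)
  fix t assume "left_inv_metric (diag_metric (A t) (B t) (C t)) \<and>
     (\<forall>x y. ((\<lambda>s. diag_metric (A s) (B s) (C s) x y) has_real_derivative
       2 * cross_curvature (diag_metric (A t) (B t) (C t)) x y) (at t within J))"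
  then have l: "left_inv_metric (diag_metric (A t) (B t) (C t))"
    and d: "\<And>x y. ((\<lambda>s. diag_metric (A s) (B s) (C s) x y) has_real_derivative
       2 * cross_curvature (diag_metric (A t) (B t) (C t)) x y) (at t within J)" by auto
  note pos = left_inv_metric_diag[OF l]
  show "?P t"
    using pos d[of "axis 1 1" "axis 1 1"] d[of "axis 2 1" "axis 2 1"] d[of "axis 3 1" "axis 3 1"]
    unfolding cross_curvature_diag[OF pos] by (simp add: diag_metric_def axis_def)
next
  fix t assume P: "?P t"
  then have "left_inv_metric (diag_metric (A t) (B t) (C t))" by (simp add: diag_metric_left_inv)
  moreover have "((\<lambda>s. diag_metric (A s) (B s) (C s) x y) has_real_derivative
       2 * cross_curvature (diag_metric (A t) (B t) (C t)) x y) (at t within J)" for x y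
  proof -
    have pos: "A t > 0" "B t > 0" "C t > 0" using P by auto
    show ?thesis
      unfolding cross_curvature_diag[OF pos] diag_metric_def
      by (rule derivative_eq_intros P[THEN conjunct2, THEN conjunct2, THEN conjunct2, THEN conjunct1]
          P[THEN conjunct2, THEN conjunct2, THEN conjunct2, THEN conjunct2, THEN conjunct1]
          P[THEN conjunct2, THEN conjunct2, THEN conjunct2, THEN conjunct2, THEN conjunct2] refl)+
        (simp add: algebra_simps)
  qed
  ultimately show "left_inv_metric (diag_metric (A t) (B t) (C t)) \<and>
     (\<forall>x y. ((\<lambda>s. diag_metric (A s) (B s) (C s) x y) has_real_derivative
       2 * cross_curvature (diag_metric (A t) (B t) (C t)) x y) (at t within J))" by blast
qed

section \<open>Ordinary differential equations\<close>

text \<open>Derivatives are taken within \<open>J\<close> because at the initial time only a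
  one-sided derivative is available; in the interior of \<open>{a..b}\<close> they become
  two-sided.\<close>

lemma mono_within_interval:
  fixes f :: "real \<Rightarrow> real"
  assumes "a \<le> b" "{a..b} \<subseteq> J"
    and d: "\<And>s. s \<in> {a..b} \<Longrightarrow> (f has_real_derivative f' s) (at s within J)"
    and nn: "\<And>s. s \<in> {a..b} \<Longrightarrow> f' s \<ge> 0"
  shows "f a \<le> f b"
proof (rule DERIV_nonneg_imp_increasing_open[OF \<open>a \<le> b\<close>])
  have d': "(f has_real_derivative f' s) (at s within {a..b})" if "s \<in> {a..b}" for s
    using d[OF that] assms(2) by (rule has_field_derivative_subset)
  show "continuous_on {a..b} f"
    using d' by (meson DERIV_continuous continuous_on_eq_continuous_within)
  show "\<exists>y. (f has_real_derivative y) (at x) \<and> 0 \<le> y" if "a < x" "x < b" for x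
    using d'[of x] nn[of x] that by (auto simp: at_within_Icc_at)
qed

lemma strict_mono_within_interval:
  fixes f :: "real \<Rightarrow> real"
  assumes "a < b" "{a..b} \<subseteq> J"
    and d: "\<And>s. s \<in> {a..b} \<Longrightarrow> (f has_real_derivative f' s) (at s within J)"
    and nn: "\<And>s. s \<in> {a..b} \<Longrightarrow> f' s > 0"
  shows "f a < f b"
proof (rule DERIV_pos_imp_increasing_open[OF \<open>a < b\<close>])
  have d': "(f has_real_derivative f' s) (at s within {a..b})" if "s \<in> {a..b}" for s
    using d[OF that] assms(2) by (rule has_field_derivative_subset)
  show "continuous_on {a..b} f"
    using d' by (meson DERIV_continuous continuous_on_eq_continuous_within)
  show "\<exists>y. (f has_real_derivative y) (at x) \<and> 0 < y" if "a < x" "x < b" for x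
    using d'[of x] nn[of x] that by (auto simp: at_within_Icc_at)
qed

section \<open>Gronwall estimates\<close>

lemma gronwall_lower:
  fixes D :: "real \<Rightarrow> real"
  assumes "0 \<le> b" "{0..b} \<subseteq> J"
    and d: "\<And>s. s \<in> {0..b} \<Longrightarrow> (D has_real_derivative D' s) (at s within J)"
    and le: "\<And>s. s \<in> {0..b} \<Longrightarrow> K * D s \<le> D' s"
  shows "D 0 * exp (K * b) \<le> D b"
proof -
  have "D 0 * exp (- (K * 0)) \<le> D b * exp (- (K * b))"
  proof (rule mono_within_interval[OF assms(1,2)])
    fix s assume s: "s \<in> {0..b}"
    show "((\<lambda>s. D s * exp (- (K * s))) has_real_derivative (D' s - K * D s) * exp (- (K * s))) (at s within J)"
      by (rule derivative_eq_intros d[OF s] refl)+ (simp add: algebra_simps)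
    show "0 \<le> (D' s - K * D s) * exp (- (K * s))" using le[OF s] by simp
  qed
  then show ?thesis by (simp add: exp_minus field_simps)
qed

lemma gronwall_upper:
  fixes D :: "real \<Rightarrow> real"
  assumes "0 \<le> b" "{0..b} \<subseteq> J"
    and d: "\<And>s. s \<in> {0..b} \<Longrightarrow> (D has_real_derivative D' s) (at s within J)"
    and le: "\<And>s. s \<in> {0..b} \<Longrightarrow> D' s \<le> K * D s"
  shows "D b \<le> D 0 * exp (K * b)"
  using gronwall_lower[of b J "\<lambda>s. - D s" "\<lambda>s. - D' s" K] assms
  by (auto intro!: derivative_eq_intros)

text \<open>Gronwall is applied to the square, since the absolute value need not be differentiable
  at zeros of \<open>w\<close>.\<close>

lemma linear_growth_bounds:
  fixes w :: "real \<Rightarrow> real"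
  assumes "0 \<le> b" "{0..b} \<subseteq> J"
    and d: "\<And>s. s \<in> {0..b} \<Longrightarrow> (w has_real_derivative w' s) (at s within J)"
    and le: "\<And>s. s \<in> {0..b} \<Longrightarrow> \<bar>w' s\<bar> \<le> M * \<bar>w s\<bar>"
  shows "\<bar>w 0\<bar> * exp (- (M * b)) \<le> \<bar>w b\<bar>" "\<bar>w b\<bar> \<le> \<bar>w 0\<bar> * exp (M * b)"
proof -
  have d2: "((\<lambda>s. (w s)\<^sup>2) has_real_derivative 2 * (w s * w' s)) (at s within J)" if "s \<in> {0..b}" for s
    by (rule derivative_eq_intros d[OF that] refl)+ simp
  have le2: "\<bar>w s * w' s\<bar> \<le> M * (w s)\<^sup>2" if "s \<in> {0..b}" for s
    using mult_left_mono[OF le[OF that], of "\<bar>w s\<bar>"]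
    by (simp add: abs_mult power2_eq_square mult.left_commute)
  have "(w 0)\<^sup>2 * exp (- (2 * M) * b) \<le> (w b)\<^sup>2" 
    by (rule gronwall_lower[OF assms(1,2) d2]) (use le2 in \<open>fastforce simp: abs_le_iff\<close>)+
  then have "(\<bar>w 0\<bar> * exp (- (M * b)))\<^sup>2 \<le> \<bar>w b\<bar>\<^sup>2"
    by (simp add: power_mult_distrib mult.assoc flip: exp_double)
  then show "\<bar>w 0\<bar> * exp (- (M * b)) \<le> \<bar>w b\<bar>" by (rule power2_le_imp_le) simp
  have "(w b)\<^sup>2 \<le> (w 0)\<^sup>2 * exp (2 * M * b)" 
    by (rule gronwall_upper[OF assms(1,2) d2]) (use le2 in \<open>fastforce simp: abs_le_iff\<close>)+
  then have "\<bar>w b\<bar>\<^sup>2 \<le> (\<bar>w 0\<bar> * exp (M * b))\<^sup>2"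
    by (simp add: power_mult_distrib mult.assoc flip: exp_double)
  then show "\<bar>w b\<bar> \<le> \<bar>w 0\<bar> * exp (M * b)" by (rule power2_le_imp_le) simp
qed

text \<open>
  Here \<open>f\<close> and \<open>g\<close> are one expression evaluated at two states whose distance is \<open>d\<close>, so the
  closure rules below yield Lipschitz estimates without differentiating the vector field.
\<close>

definition jointly_lipschitz :: "'a set \<Rightarrow> ('a \<Rightarrow> real) \<Rightarrow> ('a \<Rightarrow> real) \<Rightarrow> ('a \<Rightarrow> real) \<Rightarrow> bool" where
  "jointly_lipschitz S d f g \<longleftrightarrow>
    (\<exists>L M. \<forall>x\<in>S. \<bar>f x - g x\<bar> \<le> L * d x \<and> \<bar>f x\<bar> \<le> M \<and> \<bar>g x\<bar> \<le> M)"

section \<open>Closure rules for Lipschitz estimates\<close>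

lemma jointly_lipschitzE:
  assumes "jointly_lipschitz S d f g" and "\<And>x. x \<in> S \<Longrightarrow> d x \<ge> 0"
  obtains L M where "L \<ge> 0" "M \<ge> 0"
    "\<forall>x\<in>S. \<bar>f x - g x\<bar> \<le> L * d x \<and> \<bar>f x\<bar> \<le> M \<and> \<bar>g x\<bar> \<le> M"
proof -
  obtain L M where LM: "\<forall>x\<in>S. \<bar>f x - g x\<bar> \<le> L * d x \<and> \<bar>f x\<bar> \<le> M \<and> \<bar>g x\<bar> \<le> M"
    using assms(1) by (auto simp: jointly_lipschitz_def)
  have "L * d x \<le> \<bar>L\<bar> * d x" if "x \<in> S" for x
    using assms(2)[OF that] by (intro mult_right_mono) auto
  then show thesis using LM by (intro that[of "\<bar>L\<bar>" "\<bar>M\<bar>"]) force+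
qed

lemma jointly_lipschitz_const:
  assumes "\<And>x. x \<in> S \<Longrightarrow> d x \<ge> 0"
  shows "jointly_lipschitz S d (\<lambda>x. c) (\<lambda>x. c)"
  unfolding jointly_lipschitz_def using assms by (intro exI[of _ 0] exI[of _ "\<bar>c\<bar>"]) auto

lemma jointly_lipschitz_add:
  assumes d: "\<And>x. x \<in> S \<Longrightarrow> d x \<ge> 0"
    and "jointly_lipschitz S d f g" "jointly_lipschitz S d f' g'"
  shows "jointly_lipschitz S d (\<lambda>x. f x + f' x) (\<lambda>x. g x + g' x)"
proof -
  obtain L M where 1: "L \<ge> 0" "M \<ge> 0"
    "\<forall>x\<in>S. \<bar>f x - g x\<bar> \<le> L * d x \<and> \<bar>f x\<bar> \<le> M \<and> \<bar>g x\<bar> \<le> M"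
    by (rule jointly_lipschitzE[OF assms(2) d])
  obtain L' M' where 2: "L' \<ge> 0" "M' \<ge> 0"
    "\<forall>x\<in>S. \<bar>f' x - g' x\<bar> \<le> L' * d x \<and> \<bar>f' x\<bar> \<le> M' \<and> \<bar>g' x\<bar> \<le> M'"
    by (rule jointly_lipschitzE[OF assms(3) d])
  show ?thesis
    unfolding jointly_lipschitz_def
  proof (rule exI[of _ "L + L'"], rule exI[of _ "M + M'"], intro ballI)
    fix x assume "x \<in> S"
    then have 3: "\<bar>f x - g x\<bar> \<le> L * d x" "\<bar>f x\<bar> \<le> M" "\<bar>g x\<bar> \<le> M"
      and 4: "\<bar>f' x - g' x\<bar> \<le> L' * d x" "\<bar>f' x\<bar> \<le> M'" "\<bar>g' x\<bar> \<le> M'" using 1(3) 2(3) by auto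
    show "\<bar>f x + f' x - (g x + g' x)\<bar> \<le> (L + L') * d x \<and> \<bar>f x + f' x\<bar> \<le> M + M' \<and> \<bar>g x + g' x\<bar> \<le> M + M'"
    proof (intro conjI)
      show "\<bar>f x + f' x - (g x + g' x)\<bar> \<le> (L + L') * d x"
        unfolding distrib_right using 3(1) 4(1) by linarith
      show "\<bar>f x + f' x\<bar> \<le> M + M'" "\<bar>g x + g' x\<bar> \<le> M + M'"
        using 3(2,3) 4(2,3) by linarith+
    qed
  qed
qed

text \<open>Splitting the difference of products as \<open>(f - g) * f' + g * (f' - g')\<close>
  requires uniform bounds on the factors; this is why the relation carries \<open>M\<close> beside
  \<open>L\<close>.\<close>

lemma jointly_lipschitz_mult:
  assumes d: "\<And>x. x \<in> S \<Longrightarrow> d x \<ge> 0"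
    and "jointly_lipschitz S d f g" "jointly_lipschitz S d f' g'"
  shows "jointly_lipschitz S d (\<lambda>x. f x * f' x) (\<lambda>x. g x * g' x)"
proof -
  obtain L M where 1: "L \<ge> 0" "M \<ge> 0"
    "\<forall>x\<in>S. \<bar>f x - g x\<bar> \<le> L * d x \<and> \<bar>f x\<bar> \<le> M \<and> \<bar>g x\<bar> \<le> M"
    by (rule jointly_lipschitzE[OF assms(2) d])
  obtain L' M' where 2: "L' \<ge> 0" "M' \<ge> 0"
    "\<forall>x\<in>S. \<bar>f' x - g' x\<bar> \<le> L' * d x \<and> \<bar>f' x\<bar> \<le> M' \<and> \<bar>g' x\<bar> \<le> M'"
    by (rule jointly_lipschitzE[OF assms(3) d])
  show ?thesis
    unfolding jointly_lipschitz_def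
  proof (rule exI[of _ "L * M' + M * L'"], rule exI[of _ "M * M'"], intro ballI conjI)
    fix x assume x: "x \<in> S"
    have "f x * f' x - g x * g' x = (f x - g x) * f' x + g x * (f' x - g' x)" by algebra
    then have "\<bar>f x * f' x - g x * g' x\<bar> \<le> \<bar>f x - g x\<bar> * \<bar>f' x\<bar> + \<bar>g x\<bar> * \<bar>f' x - g' x\<bar>"
      by (metis abs_mult abs_triangle_ineq)
    also have "\<dots> \<le> (L * d x) * M' + M * (L' * d x)"
      using 1 2 x d[OF x] by (intro add_mono mult_mono) auto
    finally show "\<bar>f x * f' x - g x * g' x\<bar> \<le> (L * M' + M * L') * d x" by (simp add: algebra_simps)
    show "\<bar>f x * f' x\<bar> \<le> M * M'" "\<bar>g x * g' x\<bar> \<le> M * M'"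
      unfolding abs_mult using 1 2 x by (auto intro!: mult_mono)
  qed
qed

lemma jointly_lipschitz_diff:
  assumes "\<And>x. x \<in> S \<Longrightarrow> d x \<ge> 0"
    and "jointly_lipschitz S d f g" "jointly_lipschitz S d f' g'"
  shows "jointly_lipschitz S d (\<lambda>x. f x - f' x) (\<lambda>x. g x - g' x)"
  using jointly_lipschitz_add[OF assms(1,2) jointly_lipschitz_mult[OF assms(1)
      jointly_lipschitz_const[OF assms(1), where c = "-1"] assms(3)]] by simp

lemma jointly_lipschitz_inverse:
  assumes d: "\<And>x. x \<in> S \<Longrightarrow> d x \<ge> 0"
    and "jointly_lipschitz S d f g" and "r > 0" and r: "\<And>x. x \<in> S \<Longrightarrow> f x \<ge> r \<and> g x \<ge> r"
  shows "jointly_lipschitz S d (\<lambda>x. inverse (f x)) (\<lambda>x. inverse (g x))"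
proof -
  obtain L M where 1: "L \<ge> 0" "M \<ge> 0"
    "\<forall>x\<in>S. \<bar>f x - g x\<bar> \<le> L * d x \<and> \<bar>f x\<bar> \<le> M \<and> \<bar>g x\<bar> \<le> M"
    by (rule jointly_lipschitzE[OF assms(2) d])
  show ?thesis
    unfolding jointly_lipschitz_def
  proof (rule exI[of _ "inverse r * inverse r * L"], rule exI[of _ "inverse r"], intro ballI conjI)
    fix x assume x: "x \<in> S"
    have p: "f x > 0" "g x > 0" using r[OF x] \<open>r > 0\<close> by auto
    show i: "\<bar>inverse (f x)\<bar> \<le> inverse r" "\<bar>inverse (g x)\<bar> \<le> inverse r"
      using r[OF x] \<open>r > 0\<close> p by (auto intro: le_imp_inverse_le)
    have "inverse (f x) - inverse (g x) = inverse (f x) * inverse (g x) * (g x - f x)"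
      using p by (simp add: field_simps)
    then have "\<bar>inverse (f x) - inverse (g x)\<bar> = \<bar>inverse (f x)\<bar> * \<bar>inverse (g x)\<bar> * \<bar>f x - g x\<bar>"
      by (simp add: abs_mult abs_minus_commute)
    also have "\<dots> \<le> inverse r * inverse r * (L * d x)"
      using i 1(3)[rule_format, OF x] \<open>r > 0\<close> by (intro mult_mono) auto
    finally show "\<bar>inverse (f x) - inverse (g x)\<bar> \<le> inverse r * inverse r * L * d x"
      by (simp add: mult.assoc)
  qed
qed

section \<open>Global existence for bounded Lipschitz fields\<close>

lemma integral_has_vector_derivative_atLeast:
  fixes g :: "real \<Rightarrow> 'a::banach"
  assumes "continuous_on {0..} g" "t \<ge> 0"
  shows "((\<lambda>t. integral {0..t} g) has_vector_derivative g t) (at t within {0..})"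
proof -
  have "((\<lambda>t. integral {0..t} g) has_vector_derivative g t) (at t within {0..t+1})"
    by (rule integral_has_vector_derivative) (use assms in \<open>auto intro: continuous_on_subset\<close>)
  moreover have "at t within {0..t+1} = at t within {0..}"
    by (rule at_within_nhd[of _ "{..<t+1}"]) auto
  ultimately show ?thesis by simp
qed

text \<open>A bounded field lets Picard iterates grow at most linearly. Weighted by a decaying
  exponential they are bounded continuous functions, and one application of the fixed point theorem
  gives a solution for all times.\<close>

lemma picard_global:
  fixes f :: "'a::banach \<Rightarrow> 'a"
  assumes lip: "L-lipschitz_on UNIV f" and bdd: "\<And>x. norm (f x) \<le> M"
  obtains u where "u 0 = x0"
    "\<forall>t\<ge>0. (u has_vector_derivative f (u t)) (at t within {0..})"
proof -
  text \<open>Picard's map is a contraction in the norm weighted by \<open>exp (- 2 K t)\<close>.\<close>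
  define K where "K = max L 1"
  have K: "K \<ge> 1" by (simp add: K_def)
  have lipK: "norm (f x - f y) \<le> K * norm (x - y)" for x y
  proof -
    have "norm (f x - f y) \<le> L * norm (x - y)"
      using lip by (auto simp: lipschitz_on_def dist_norm)
    also have "\<dots> \<le> K * norm (x - y)" by (intro mult_right_mono) (auto simp: K_def)
    finally show ?thesis .
  qed
  have contf: "continuous_on UNIV f" using lip by (rule lipschitz_on_continuous_on)
  have M: "M \<ge> 0" using bdd[of 0] norm_ge_zero order_trans by blast
  \<comment> \<open>The unknown \<open>v\<close> stands for
    \<open>exp (- (2 * K * t)) *\<^sub>R u t\<close>; this turns the weighted norm of
    \<open>u\<close> into the plain sup norm of \<open>v\<close>.\<close>
  define I where "I v t = integral {0..t} (\<lambda>s. f (exp (2 * K * s) *\<^sub>R v s))" for v t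
  have cont_int: "continuous_on S (\<lambda>s. f (exp (2 * K * s) *\<^sub>R v s))" if "continuous_on UNIV v" for v S
    by (intro continuous_on_compose2[OF contf] continuous_intros continuous_on_subset[OF that]) auto
  have integrable: "(\<lambda>s. f (exp (2 * K * s) *\<^sub>R v s)) integrable_on {0..t}" if "continuous_on UNIV v" for v t
    by (intro integrable_continuous_real cont_int that)
  have I_deriv: "((\<lambda>t. I v t) has_vector_derivative f (exp (2 * K * t) *\<^sub>R v t)) (at t within {0..})"
    if "continuous_on UNIV v" "t \<ge> 0" for v t
    unfolding I_def using that by (intro integral_has_vector_derivative_atLeast cont_int)
  \<comment> \<open>Bounded continuous functions live on the whole line, so negative times receive
    the value at 0.\<close>
  define \<Psi> where "\<Psi> v t = exp (- (2 * K * max 0 t)) *\<^sub>R (x0 + I v (max 0 t))" for v t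
  have \<Psi>: "\<Psi> v \<in> bcontfun" if v: "continuous_on UNIV v" for v
  proof (rule bcontfun_normI)
    have "continuous_on {0..} (I v)"
      using I_deriv[OF v] by (auto simp: continuous_on_eq_continuous_within
          intro!: has_vector_derivative_continuous)
    then have "continuous_on UNIV (\<lambda>t. I v (max 0 t))"
      by (rule continuous_on_compose2) (auto intro!: continuous_intros)
    then show "continuous_on UNIV (\<Psi> v)"
      unfolding \<Psi>_def by (intro continuous_intros)
    show "norm (\<Psi> v t) \<le> norm x0 + M" for t
    proof -
      define r where "r = max 0 t"
      have r: "r \<ge> 0" by (simp add: r_def)
      have "norm (I v r) \<le> M * r"
        unfolding I_def using integral_bound[of 0 r] r cont_int[OF v] bdd
        by (metis (no_types, lifting) diff_zero)
      then have "norm (x0 + I v r) \<le> norm x0 + M * r" by (rule norm_triangle_le[OF add_left_mono])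
      then have "norm (\<Psi> v t) \<le> exp (- (2 * K * r)) * (norm x0 + M * r)"
        unfolding \<Psi>_def r_def by simp
      also have "\<dots> = exp (- (2 * K * r)) * norm x0 + M * (exp (- (2 * K * r)) * r)" by (simp add: algebra_simps)
      also have "\<dots> \<le> 1 * norm x0 + M * 1"
      proof (intro add_mono mult_right_mono mult_left_mono M)
        show "exp (- (2 * K * r)) \<le> 1" using K r by simp
        have "r \<le> 2 * K * r" using K r by (simp add: mult_le_cancel_right1)
        also have "\<dots> \<le> exp (2 * K * r)" using exp_ge_add_one_self[of "2 * K * r"] by linarith
        finally show "exp (- (2 * K * r)) * r \<le> 1" by (simp add: exp_minus field_simps)
      qed simp
      finally show ?thesis by simp
    qed
  qed
  define \<Phi> where "\<Phi> v = Bcontfun (\<Psi> (apply_bcontfun v))" for v :: "real \<Rightarrow>\<^sub>C 'a"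
  have \<Phi>: "apply_bcontfun (\<Phi> v) = \<Psi> (apply_bcontfun v)" for v
    unfolding \<Phi>_def by (rule Bcontfun_inverse[OF \<Psi>]) simp
  have contr: "dist (\<Phi> v) (\<Phi> w) \<le> 1/2 * dist v w" for v w
  proof (rule dist_bound)
    fix t :: real
    define r where "r = max 0 t"
    have r: "r \<ge> 0" by (simp add: r_def)
    define \<delta> where "\<delta> = dist v w"
    have "norm (I v r - I w r) = norm (integral {0..r} (\<lambda>s. f (exp (2 * K * s) *\<^sub>R v s) - f (exp (2 * K * s) *\<^sub>R w s)))"
      unfolding I_def by (subst Henstock_Kurzweil_Integration.integral_diff) (auto intro!: integrable)
    also have "\<dots> \<le> integral {0..r} (\<lambda>s. K * \<delta> * exp (2 * K * s))"
    proof (rule integral_norm_bound_integral)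
      fix s assume "s \<in> {0..r}"
      have "norm (f (exp (2 * K * s) *\<^sub>R v s) - f (exp (2 * K * s) *\<^sub>R w s)) \<le> K * norm (exp (2 * K * s) *\<^sub>R (v s - w s))"
        using lipK[of "exp (2 * K * s) *\<^sub>R v s"] by (simp add: scaleR_diff_right)
      also have "\<dots> \<le> K * (exp (2 * K * s) * \<delta>)"
        using dist_bounded[of v s w] K by (simp add: \<delta>_def dist_norm)
      finally show "norm (f (exp (2 * K * s) *\<^sub>R v s) - f (exp (2 * K * s) *\<^sub>R w s)) \<le> K * \<delta> * exp (2 * K * s)"
        by (simp add: mult_ac)
    qed (auto intro!: integrable_continuous_real continuous_intros cont_int)
    \<comment> \<open>Integrating the weight gains \<open>1 / (2 * K)\<close>, which cancels the
      Lipschitz constant and leaves the contraction factor 1/2.\<close>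
    also have "\<dots> = \<delta> / 2 * exp (2 * K * r) - \<delta> / 2 * exp (2 * K * 0)"
    proof (rule integral_unique, rule fundamental_theorem_of_calculus[OF r])
      show "((\<lambda>s. \<delta> / 2 * exp (2 * K * s)) has_vector_derivative K * \<delta> * exp (2 * K * s)) (at s within {0..r})" for s
        unfolding has_real_derivative_iff_has_vector_derivative[symmetric]
        by (rule derivative_eq_intros refl)+ simp
    qed
    also have "\<dots> \<le> \<delta> / 2 * exp (2 * K * r)" by (simp add: \<delta>_def)
    finally have *: "norm (I v r - I w r) \<le> \<delta> / 2 * exp (2 * K * r)" .
    have "dist (\<Phi> v t) (\<Phi> w t) = exp (- (2 * K * r)) * norm (I v r - I w r)"
      unfolding \<Phi> \<Psi>_def r_def[symmetric] dist_norm by (simp flip: scaleR_diff_right)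
    also have "\<dots> \<le> exp (- (2 * K * r)) * (\<delta> / 2 * exp (2 * K * r))" using * by simp
    also have "\<dots> = \<delta> / 2" by (simp add: exp_minus)
    finally show "dist (\<Phi> v t) (\<Phi> w t) \<le> 1/2 * dist v w" by (simp add: \<delta>_def)
  qed
  obtain v where v: "\<Phi> v = v"
    using banach_fix_type[of "1/2" \<Phi>] contr by auto
  have vv: "v t = \<Psi> v t" for t using \<Phi>[of v] v by simp
  define u where "u t = x0 + I v t" for t
  have eq: "exp (2 * K * t) *\<^sub>R v t = u t" if "t \<ge> 0" for t
    using that unfolding u_def vv[of t] \<Psi>_def by (simp add: exp_minus max_absorb2)
  show thesis
  proof (rule that[of u])
    show "u 0 = x0" by (simp add: u_def I_def)
    have "(u has_vector_derivative f (u t)) (at t within {0..})" if "t \<ge> 0" for t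
      unfolding u_def using I_deriv[of v, OF _ that] eq[OF that]
      by (auto intro!: derivative_eq_intros simp: u_def)
    then show "\<forall>t\<ge>0. (u has_vector_derivative f (u t)) (at t within {0..})" by blast
  qed
qed

section \<open>The system for the ratios\<close>

text \<open>
  In terms of \<open>u = B/A\<close> and \<open>v = C/A\<close>, the polynomials of the ODE system are \<open>X = A\<^sup>2 P\<close>,
  \<open>Y = A\<^sup>2 Q\<close> and \<open>Z = A\<^sup>2 R\<close>.
\<close>

definition ratio_P :: "real \<Rightarrow> real \<Rightarrow> real" where
  "ratio_P u v = 3 - (u - v)\<^sup>2 - 2*u - 2 * v"

definition ratio_Q :: "real \<Rightarrow> real \<Rightarrow> real" where
  "ratio_Q u v = 3*u\<^sup>2 - (1 - v)\<^sup>2 - 2*u - 2*u * v"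

definition ratio_R :: "real \<Rightarrow> real \<Rightarrow> real" where
  "ratio_R u v = 3 * v\<^sup>2 - (1 - u)\<^sup>2 - 2 * v - 2*u * v"

definition unit_clamp :: "real \<Rightarrow> real" where
  "unit_clamp x = max 0 (min 1 x)"

lemma unit_clamp_bounds: "0 \<le> unit_clamp x" "unit_clamp x \<le> 1"
  by (auto simp: unit_clamp_def)

lemma unit_clamp_id: "0 \<le> x \<Longrightarrow> x \<le> 1 \<Longrightarrow> unit_clamp x = x"
  by (auto simp: unit_clamp_def)

text \<open>It is not known in advance that solutions stay in the unit interval. These bounds
  dominate the clamped factors \<open>x\<close> and \<open>1 - x\<close> of the vector field by the
  unclamped quantities everywhere.\<close>

lemma abs_unit_clamp_le: "\<bar>unit_clamp x\<bar> \<le> \<bar>x\<bar>" "\<bar>1 - unit_clamp x\<bar> \<le> \<bar>1 - x\<bar>"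
  by (auto simp: unit_clamp_def)

lemma jointly_lipschitz_lipschitz_on:
  assumes "jointly_lipschitz UNIV (\<lambda>(p, q). dist p q) (\<lambda>(p, q). f p) (\<lambda>(p, q). f q)"
  obtains L M where "L-lipschitz_on UNIV f" "\<forall>x. norm (f x) \<le> M"
proof -
  obtain L M where LM: "L \<ge> 0" "\<forall>x. case x of (p, q) \<Rightarrow> \<bar>f p - f q\<bar> \<le> L * dist p q \<and> \<bar>f p\<bar> \<le> M"
    by (rule jointly_lipschitzE[OF assms]) (auto split: prod.splits)
  show thesis
    by (rule that[of L M]) (use LM in \<open>auto simp: lipschitz_on_def dist_real_def\<close>)
qed

text \<open>
  Clamping makes the vector field bounded and globally Lipschitz; by invariance of the triangle it
  does not change the solutions of interest.
\<close>

lemma ratio_flow_clamped: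
  obtains u v where "u 0 = u0" "v 0 = v0"
    "\<forall>s\<ge>0. (u has_real_derivative
       (let x = unit_clamp (u s); y = unit_clamp (v s) in 4*x * (1-x) * (1+x-y) * ratio_R x y)) (at s within {0..})"
    "\<forall>s\<ge>0. (v has_real_derivative
       (let x = unit_clamp (u s); y = unit_clamp (v s) in 4*y * (1-y) * (1+y-x) * ratio_Q x y)) (at s within {0..})"
proof -
  define F1 :: "real \<times> real \<Rightarrow> real" where "F1 p =
    (let x = unit_clamp (fst p); y = unit_clamp (snd p) in 4*x * (1-x) * (1+x-y) * ratio_R x y)" for p
  define F2 :: "real \<times> real \<Rightarrow> real" where "F2 p =
    (let x = unit_clamp (fst p); y = unit_clamp (snd p) in 4*y * (1-y) * (1+y-x) * ratio_Q x y)" for p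
  let ?S = "UNIV :: ((real \<times> real) \<times> real \<times> real) set" and ?d = "\<lambda>x. dist (fst x) (snd x)"
  have d: "?d x \<ge> 0" for x by simp
  have j: "jointly_lipschitz ?S ?d (\<lambda>x. unit_clamp (fst (fst x))) (\<lambda>x. unit_clamp (fst (snd x)))"
    "jointly_lipschitz ?S ?d (\<lambda>x. unit_clamp (snd (fst x))) (\<lambda>x. unit_clamp (snd (snd x)))"
    unfolding jointly_lipschitz_def
  proof -
    have *: "\<bar>unit_clamp x - unit_clamp y\<bar> \<le> dist x y" for x y
      by (auto simp: unit_clamp_def dist_real_def)
    show "\<exists>L M. \<forall>x\<in>?S. \<bar>unit_clamp (fst (fst x)) - unit_clamp (fst (snd x))\<bar> \<le> L * ?d x \<and>
        \<bar>unit_clamp (fst (fst x))\<bar> \<le> M \<and> \<bar>unit_clamp (fst (snd x))\<bar> \<le> M"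
      by (rule exI[of _ 1], rule exI[of _ 1])
        (use unit_clamp_bounds * dist_fst_le order_trans in \<open>fastforce\<close>)
    show "\<exists>L M. \<forall>x\<in>?S. \<bar>unit_clamp (snd (fst x)) - unit_clamp (snd (snd x))\<bar> \<le> L * ?d x \<and>
        \<bar>unit_clamp (snd (fst x))\<bar> \<le> M \<and> \<bar>unit_clamp (snd (snd x))\<bar> \<le> M"
      by (rule exI[of _ 1], rule exI[of _ 1])
        (use unit_clamp_bounds * dist_snd_le order_trans in \<open>fastforce\<close>)
  qed
  note jl = jointly_lipschitz_add jointly_lipschitz_diff jointly_lipschitz_mult jointly_lipschitz_const d j
  have "jointly_lipschitz ?S ?d (\<lambda>x. F1 (fst x)) (\<lambda>x. F1 (snd x))"
    unfolding F1_def Let_def ratio_R_def power2_eq_square by (intro jl)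
  then obtain L1 M1 where 1: "L1-lipschitz_on UNIV F1" "\<forall>x. norm (F1 x) \<le> M1"
    by (rule jointly_lipschitz_lipschitz_on[of F1, unfolded case_prod_unfold])
  have "jointly_lipschitz ?S ?d (\<lambda>x. F2 (fst x)) (\<lambda>x. F2 (snd x))"
    unfolding F2_def Let_def ratio_Q_def power2_eq_square by (intro jl)
  then obtain L2 M2 where 2: "L2-lipschitz_on UNIV F2" "\<forall>x. norm (F2 x) \<le> M2"
    by (rule jointly_lipschitz_lipschitz_on[of F2, unfolded case_prod_unfold])
  have "(sqrt (L1\<^sup>2 + L2\<^sup>2))-lipschitz_on UNIV (\<lambda>p. (F1 p, F2 p))"
    by (rule lipschitz_on_Pair[OF 1(1) 2(1)])
  moreover have "norm (F1 p, F2 p) \<le> M1 + M2" for p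
    using 1(2)[rule_format, of p] 2(2)[rule_format, of p] norm_Pair_le[of "F1 p" "F2 p"] by linarith
  ultimately obtain w where w: "w 0 = (u0, v0)"
    "\<forall>t\<ge>0. (w has_vector_derivative (F1 (w t), F2 (w t))) (at t within {0..})"
    by (rule picard_global)
  show thesis
  proof (rule that[of "\<lambda>s. fst (w s)" "\<lambda>s. snd (w s)"])
    show "fst (w 0) = u0" "snd (w 0) = v0" using w(1) by auto
    have "((\<lambda>s. fst (w s)) has_real_derivative F1 (w s)) (at s within {0..})"
      "((\<lambda>s. snd (w s)) has_real_derivative F2 (w s)) (at s within {0..})" if "s \<ge> 0" for s
      using has_derivative_fst[OF w(2)[rule_format, OF that, unfolded has_vector_derivative_def]]
        has_derivative_snd[OF w(2)[rule_format, OF that, unfolded has_vector_derivative_def]]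
      by (simp_all add: has_field_derivative_def mult_commute_abs)
    then show "\<forall>s\<ge>0. ((\<lambda>s. fst (w s)) has_real_derivative
       (let x = unit_clamp (fst (w s)); y = unit_clamp (snd (w s)) in 4*x * (1-x) * (1+x-y) * ratio_R x y)) (at s within {0..})"
      "\<forall>s\<ge>0. ((\<lambda>s. snd (w s)) has_real_derivative
       (let x = unit_clamp (fst (w s)); y = unit_clamp (snd (w s)) in 4*y * (1-y) * (1+y-x) * ratio_Q x y)) (at s within {0..})"
      unfolding F1_def F2_def by blast+
  qed
qed

section \<open>Invariance of the triangle\<close>

lemma ratio_bounds:
  assumes "0 \<le> u" "u \<le> 1" "0 \<le> v" "v \<le> 1"
  shows "\<bar>ratio_P u v\<bar> \<le> 5" "\<bar>ratio_Q u v\<bar> \<le> 5" "\<bar>ratio_R u v\<bar> \<le> 5"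
proof -
  have "0 \<le> u\<^sup>2" "u\<^sup>2 \<le> 1" "0 \<le> v\<^sup>2" "v\<^sup>2 \<le> 1" "0 \<le> (u-v)\<^sup>2" "(u-v)\<^sup>2 \<le> 1" "0 \<le> u * v" "u * v \<le> 1"
     "0 \<le> (1-u)\<^sup>2" "(1-u)\<^sup>2 \<le> 1" "0 \<le> (1-v)\<^sup>2" "(1-v)\<^sup>2 \<le> 1"
    using assms by (auto simp: power_le_one mult_le_one abs_le_iff abs_square_le_1)
  moreover have "u * v \<le> u" "u * v \<le> v" using assms by (auto simp: mult_left_le mult_left_le_one_le)
  moreover have "(u-v)\<^sup>2 = u\<^sup>2 - 2 * (u * v) + v\<^sup>2" "(1-u)\<^sup>2 = 1 - 2*u + u\<^sup>2" "(1-v)\<^sup>2 = 1 - 2 * v + v\<^sup>2"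
    by (simp_all add: power2_eq_square algebra_simps)
  ultimately show "\<bar>ratio_P u v\<bar> \<le> 5" "\<bar>ratio_Q u v\<bar> \<le> 5" "\<bar>ratio_R u v\<bar> \<le> 5"
    unfolding ratio_P_def ratio_Q_def ratio_R_def abs_le_iff mult.assoc using assms by linarith+
qed

text \<open>At a zero of \<open>w\<close> the exponential lower bound would fail, so a positive
  solution never reaches zero and cannot change sign by the intermediate value theorem.\<close>

lemma linear_growth_sign:
  fixes w :: "real \<Rightarrow> real"
  assumes d: "\<And>s. s \<ge> 0 \<Longrightarrow> (w has_real_derivative w' s) (at s within {0..})"
    and le: "\<And>s. s \<ge> 0 \<Longrightarrow> \<bar>w' s\<bar> \<le> M * \<bar>w s\<bar>" and "b \<ge> 0"
  shows "w 0 > 0 \<Longrightarrow> w b > 0" "w 0 = 0 \<Longrightarrow> w b = 0"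
proof -
  have bnd: "\<bar>w 0\<bar> * exp (- (M * c)) \<le> \<bar>w c\<bar>" "\<bar>w c\<bar> \<le> \<bar>w 0\<bar> * exp (M * c)" if "c \<ge> 0" for c
    by (rule linear_growth_bounds[of c "{0..}" w w' M]; use d le that in auto)+
  show "w b = 0" if "w 0 = 0" using bnd(2)[OF \<open>b \<ge> 0\<close>] that by simp
  show "w b > 0" if 0: "w 0 > 0"
  proof (rule ccontr)
    assume "\<not> w b > 0"
    moreover have "continuous_on {0..} w"
      using d by (auto simp: continuous_on_eq_continuous_within intro: DERIV_continuous)
    then have "continuous_on {0..b} w" by (rule continuous_on_subset) auto
    ultimately obtain c where "0 \<le> c" "w c = 0"
      using IVT2'[of w b 0 0] 0 \<open>b \<ge> 0\<close> by force
    then show False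
      using bnd(1)[of c, unfolded abs_of_pos[OF 0]] mult_pos_pos[OF 0 exp_gt_zero, of "- (M * c)"] by simp
  qed
qed

text \<open>The factors \<open>1 - u\<close>, \<open>1 - v\<close> and \<open>v - u\<close> make the
  lines \<open>u = 1\<close>, \<open>v = 1\<close> and \<open>u = v\<close> invariant for the ratio
  system.\<close>

lemma ratio_factor:
  "ratio_P u v - ratio_Q u v = 4 * (1 - u) * (1 + u - v)"
  "ratio_P u v - ratio_R u v = 4 * (1 - v) * (1 + v - u)"
  "ratio_R u v - ratio_Q u v = 4 * (v - u) * (u + v - 1)"
  unfolding ratio_P_def ratio_Q_def ratio_R_def by algebra+

text \<open>Each side of the triangle is the zero set of a function whose derivative is bounded by a
  multiple of itself. The order matters: the clamped system first keeps the unit square; then the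
  clamp is inactive, and only for the unclamped system does \<open>u - v\<close> factor out.\<close>

lemma ratio_flow:
  assumes "0 < v0" "v0 \<le> u0" "u0 \<le> 1"
  obtains u v where "u 0 = u0" "v 0 = v0"
    "\<forall>s\<ge>0. (u has_real_derivative u s * ratio_R (u s) (v s) * (ratio_P (u s) (v s) - ratio_Q (u s) (v s)))
       (at s within {0..})"
    "\<forall>s\<ge>0. (v has_real_derivative v s * ratio_Q (u s) (v s) * (ratio_P (u s) (v s) - ratio_R (u s) (v s)))
       (at s within {0..})"
    "\<forall>s\<ge>0. 0 < v s \<and> v s \<le> u s \<and> u s \<le> 1"
    "u0 < 1 \<longrightarrow> (\<forall>s\<ge>0. u s < 1)" "u0 = 1 \<longrightarrow> (\<forall>s\<ge>0. u s = 1)" "v0 < 1 \<longrightarrow> (\<forall>s\<ge>0. v s < 1)"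
proof -
  \<comment> \<open>One argument serves both coordinates; \<open>g\<close> collects the bounded
    factors, while \<open>x\<close> and \<open>1 - x\<close> protect the values 0 and 1.\<close>
  have lin: "((0 < w0 \<longrightarrow> (\<forall>s\<ge>0. 0 < w s)) \<and> (w0 < 1 \<longrightarrow> (\<forall>s\<ge>0. w s < 1)) \<and> (w0 = 1 \<longrightarrow> (\<forall>s\<ge>0. w s = 1)))"
    if w0: "w 0 = w0" and d: "\<forall>s\<ge>0. (w has_real_derivative
       (let x = unit_clamp (w s) in 4 * x * (1 - x) * g s)) (at s within {0..})"
      and g: "\<forall>s\<ge>0. \<bar>g s\<bar> \<le> 10" for w w0 and g :: "real \<Rightarrow> real"
  proof -
    let ?x = "\<lambda>s. unit_clamp (w s)"
    have 1: "\<bar>4 * ?x s * (1 - ?x s) * g s\<bar> \<le> 40 * \<bar>w s\<bar>" "\<bar>4 * ?x s * (1 - ?x s) * g s\<bar> \<le> 40 * \<bar>1 - w s\<bar>"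
      if "s \<ge> 0" for s
    proof -
      have gs: "\<bar>g s\<bar> \<le> 10" using g that by blast
      have x: "0 \<le> ?x s" "?x s \<le> 1" using unit_clamp_bounds by auto
      have "\<bar>4 * ?x s * (1 - ?x s) * g s\<bar> = 4 * (\<bar>?x s\<bar> * (\<bar>1 - ?x s\<bar> * \<bar>g s\<bar>))" by (simp add: abs_mult)
      also have "\<dots> \<le> 4 * (\<bar>w s\<bar> * (1 * 10))"
        using gs x abs_unit_clamp_le(1)[of "w s"] by (intro mult_left_mono mult_mono) auto
      finally show "\<bar>4 * ?x s * (1 - ?x s) * g s\<bar> \<le> 40 * \<bar>w s\<bar>" by simp
      have "\<bar>4 * ?x s * (1 - ?x s) * g s\<bar> = 4 * (\<bar>1 - ?x s\<bar> * (\<bar>?x s\<bar> * \<bar>g s\<bar>))" by (simp add: abs_mult)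
      also have "\<dots> \<le> 4 * (\<bar>1 - w s\<bar> * (1 * 10))"
        using gs x abs_unit_clamp_le(2)[of "w s"] by (intro mult_left_mono mult_mono) auto
      finally show "\<bar>4 * ?x s * (1 - ?x s) * g s\<bar> \<le> 40 * \<bar>1 - w s\<bar>" by simp
    qed
    have d': "(w has_real_derivative 4 * ?x s * (1 - ?x s) * g s) (at s within {0..})" if "s \<ge> 0" for s
      using d that by (simp add: Let_def)
    have d1: "((\<lambda>s. 1 - w s) has_real_derivative - (4 * ?x s * (1 - ?x s) * g s)) (at s within {0..})" if "s \<ge> 0" for s
      by (rule derivative_eq_intros d'[OF that] refl)+ simp
    note s1 = linear_growth_sign[OF d' 1(1)]
    have s2: "1 - w 0 > 0 \<Longrightarrow> 1 - w b > 0" "1 - w 0 = 0 \<Longrightarrow> 1 - w b = 0" if "b \<ge> 0" for b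
      by (rule linear_growth_sign[OF d1, of 40]; use 1(2) that in simp)+
    have "w s > 0" if "w0 > 0" "s \<ge> 0" for s using s1(1)[of s] that w0 by simp
    moreover have "w s < 1" if "w0 < 1" "s \<ge> 0" for s using s2(1)[of s] that w0 by simp
    moreover have "w s = 1" if "w0 = 1" "s \<ge> 0" for s using s2(2)[of s] that w0 by simp
    ultimately show ?thesis by blast
  qed
  obtain u v where uv0: "u 0 = u0" "v 0 = v0" and
    du: "\<forall>s\<ge>0. (u has_real_derivative
       (let x = unit_clamp (u s); y = unit_clamp (v s) in 4 * x * (1 - x) * (1 + x - y) * ratio_R x y)) (at s within {0..})"
    and dv: "\<forall>s\<ge>0. (v has_real_derivative
       (let x = unit_clamp (u s); y = unit_clamp (v s) in 4 * y * (1 - y) * (1 + y - x) * ratio_Q x y)) (at s within {0..})"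
    by (rule ratio_flow_clamped)
  have b10: "\<bar>(1 + x - y) * r\<bar> \<le> 10" if "0 \<le> x" "x \<le> 1" "0 \<le> y" "y \<le> 1" "\<bar>r\<bar> \<le> 5" for x y r :: real
  proof -
    have "\<bar>1 + x - y\<bar> * \<bar>r\<bar> \<le> 2 * 5" using that by (intro mult_mono) auto
    then show ?thesis by (simp add: abs_mult)
  qed
  have U: "((0 < u0 \<longrightarrow> (\<forall>s\<ge>0. 0 < u s)) \<and> (u0 < 1 \<longrightarrow> (\<forall>s\<ge>0. u s < 1)) \<and> (u0 = 1 \<longrightarrow> (\<forall>s\<ge>0. u s = 1)))"
    by (rule lin[where g = "\<lambda>s. (1 + unit_clamp (u s) - unit_clamp (v s)) * ratio_R (unit_clamp (u s)) (unit_clamp (v s))"])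
      (use uv0 du in \<open>simp_all only: Let_def mult.assoc\<close>, intro allI impI b10 ratio_bounds unit_clamp_bounds)
  have V: "((0 < v0 \<longrightarrow> (\<forall>s\<ge>0. 0 < v s)) \<and> (v0 < 1 \<longrightarrow> (\<forall>s\<ge>0. v s < 1)) \<and> (v0 = 1 \<longrightarrow> (\<forall>s\<ge>0. v s = 1)))"
    by (rule lin[where g = "\<lambda>s. (1 + unit_clamp (v s) - unit_clamp (u s)) * ratio_Q (unit_clamp (u s)) (unit_clamp (v s))"])
      (use uv0 dv in \<open>simp_all only: Let_def mult.assoc\<close>, intro allI impI b10 ratio_bounds unit_clamp_bounds)
  have range: "0 < u s" "u s \<le> 1" "0 < v s" "v s \<le> 1" if "s \<ge> 0" for s
  proof -
    have "0 < u0" "v0 \<le> 1" using assms by auto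
    then show "0 < u s" "u s \<le> 1" "0 < v s" "v s \<le> 1"
      using U V assms that by (auto simp: le_less)
  qed
  have cl: "unit_clamp (u s) = u s" "unit_clamp (v s) = v s" if "s \<ge> 0" for s
    using range[OF that] by (auto intro: unit_clamp_id)
  have du': "(u has_real_derivative u s * ratio_R (u s) (v s) * (ratio_P (u s) (v s) - ratio_Q (u s) (v s)))
       (at s within {0..})" if "s \<ge> 0" for s
    using du[rule_format, OF that] unfolding Let_def cl[OF that] by (simp add: ratio_factor mult_ac)
  have dv': "(v has_real_derivative v s * ratio_Q (u s) (v s) * (ratio_P (u s) (v s) - ratio_R (u s) (v s)))
       (at s within {0..})" if "s \<ge> 0" for s
    using dv[rule_format, OF that] unfolding Let_def cl[OF that] by (simp add: ratio_factor mult_ac)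
  \<comment> \<open>The cofactor of \<open>u - v\<close> in the difference of the two equations,
    found from \<open>u * R - v * Q = (u - v) * R + v * (R - Q)\<close>. Its three terms are at most
    25, 20 and 25, hence the bound 70.\<close>
  define h where "h s = ratio_P (u s) (v s) * ratio_R (u s) (v s)
      - 4 * ratio_P (u s) (v s) * (v s * (u s + v s - 1)) - ratio_Q (u s) (v s) * ratio_R (u s) (v s)" for s
  have dw: "((\<lambda>s. u s - v s) has_real_derivative (u s - v s) * h s) (at s within {0..})" if "s \<ge> 0" for s
  proof -
    have "u s * ratio_R (u s) (v s) * (ratio_P (u s) (v s) - ratio_Q (u s) (v s))
      - v s * ratio_Q (u s) (v s) * (ratio_P (u s) (v s) - ratio_R (u s) (v s)) = (u s - v s) * h s"
      unfolding h_def using ratio_factor(3)[of "u s" "v s"] by algebra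
    then show ?thesis using DERIV_diff[OF du'[OF that] dv'[OF that]] by simp
  qed
  have hb: "\<bar>h s\<bar> \<le> 70" if "s \<ge> 0" for s
  proof -
    note r = range[OF that] and b = ratio_bounds[of "u s" "v s"]
    have 1: "\<bar>ratio_P (u s) (v s) * ratio_R (u s) (v s)\<bar> \<le> 5 * 5" "\<bar>ratio_Q (u s) (v s) * ratio_R (u s) (v s)\<bar> \<le> 5 * 5"
      unfolding abs_mult by (intro mult_mono b; use r in simp)+
    have "\<bar>v s\<bar> * \<bar>u s + v s - 1\<bar> \<le> 1 * 1" using r by (intro mult_mono) auto
    then have "\<bar>ratio_P (u s) (v s)\<bar> * (\<bar>v s\<bar> * \<bar>u s + v s - 1\<bar>) \<le> 5 * 1"
      using r b by (intro mult_mono) auto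
    then have 2: "\<bar>4 * ratio_P (u s) (v s) * (v s * (u s + v s - 1))\<bar> \<le> 20"
      by (simp add: abs_mult mult_ac)
    show ?thesis unfolding h_def using 1 2 by linarith
  qed
  have le: "v s \<le> u s" if "s \<ge> 0" for s
  proof -
    have "\<bar>(u s - v s) * h s\<bar> \<le> 70 * \<bar>u s - v s\<bar>" if "s \<ge> 0" for s
      using mult_right_mono[OF hb[OF that], of "\<bar>u s - v s\<bar>"] by (simp add: abs_mult mult.commute)
    from linear_growth_sign[OF dw this that] show ?thesis
      using assms(2) uv0 by force
  qed
  show thesis
    by (rule that[of u v]) (use uv0 du' dv' range le U V in auto)
qed

section \<open>The flow in the new time\<close>

lemma antiderivative_atLeast:
  fixes g :: "real \<Rightarrow> real"
  assumes "continuous_on {0..} g"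
  obtains G where "G 0 = 0" "\<forall>s\<ge>0. (G has_real_derivative g s) (at s within {0..})"
  using integral_has_vector_derivative_atLeast[OF assms]
  by (intro that[of "\<lambda>t. integral {0..t} g"]) (auto simp: has_real_derivative_iff_has_vector_derivative)

text \<open>Here \<open>a\<close>, \<open>u\<close>, \<open>v\<close> are \<open>A\<close>,
  \<open>B/A\<close>, \<open>C/A\<close> as functions of \<open>s\<close>, and \<open>\<tau>\<close>
  is the flow time. The last three assumptions record on which part of the triangle the solution
  moves and separate the cases of the theorem.\<close>

locale xcf_parametrization =
  fixes A0 B0 C0 :: real and u v a \<tau> :: "real \<Rightarrow> real"
  assumes A0_pos: "A0 > 0" and a0: "a 0 = A0" and u0: "u 0 = B0 / A0" and v0: "v 0 = C0 / A0"
    and \<tau>0: "\<tau> 0 = 0"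
    and du: "s \<ge> 0 \<Longrightarrow> (u has_real_derivative
       u s * ratio_R (u s) (v s) * (ratio_P (u s) (v s) - ratio_Q (u s) (v s))) (at s within {0..})"
    and dv: "s \<ge> 0 \<Longrightarrow> (v has_real_derivative
       v s * ratio_Q (u s) (v s) * (ratio_P (u s) (v s) - ratio_R (u s) (v s))) (at s within {0..})"
    and da: "s \<ge> 0 \<Longrightarrow> (a has_real_derivative a s * (ratio_Q (u s) (v s) * ratio_R (u s) (v s))) (at s within {0..})"
    and d\<tau>: "s \<ge> 0 \<Longrightarrow> (\<tau> has_real_derivative (a s)\<^sup>2 * (u s)\<^sup>2 * (v s)\<^sup>2 / 2) (at s within {0..})"
    and a_pos: "s \<ge> 0 \<Longrightarrow> a s > 0" and v_pos: "s \<ge> 0 \<Longrightarrow> v s > 0" and v_le_u: "s \<ge> 0 \<Longrightarrow> v s \<le> u s"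
    and u_le_1: "s \<ge> 0 \<Longrightarrow> u s \<le> 1"
    and u_less_1: "B0 < A0 \<Longrightarrow> s \<ge> 0 \<Longrightarrow> u s < 1"
    and u_eq_1: "B0 = A0 \<Longrightarrow> s \<ge> 0 \<Longrightarrow> u s = 1"
    and v_less_1: "C0 < A0 \<Longrightarrow> s \<ge> 0 \<Longrightarrow> v s < 1"

lemma xcf_parametrization_exists:
  assumes "A0 \<ge> B0" "B0 \<ge> C0" "C0 > 0"
  obtains u v a \<tau> where "xcf_parametrization A0 B0 C0 u v a \<tau>"
proof -
  have "0 < C0 / A0" "C0 / A0 \<le> B0 / A0" "B0 / A0 \<le> 1" using assms by (auto simp: divide_le_eq divide_right_mono)
  from ratio_flow[OF this]
  obtain u v where uv: "u 0 = B0 / A0" "v 0 = C0 / A0"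
    and du: "\<forall>s\<ge>0. (u has_real_derivative u s * ratio_R (u s) (v s) * (ratio_P (u s) (v s) - ratio_Q (u s) (v s)))
       (at s within {0..})"
    and dv: "\<forall>s\<ge>0. (v has_real_derivative v s * ratio_Q (u s) (v s) * (ratio_P (u s) (v s) - ratio_R (u s) (v s)))
       (at s within {0..})"
    and r: "\<forall>s\<ge>0. 0 < v s \<and> v s \<le> u s \<and> u s \<le> 1"
    "B0 / A0 < 1 \<longrightarrow> (\<forall>s\<ge>0. u s < 1)" "B0 / A0 = 1 \<longrightarrow> (\<forall>s\<ge>0. u s = 1)" "C0 / A0 < 1 \<longrightarrow> (\<forall>s\<ge>0. v s < 1)" .
  have cu: "continuous_on {0..} u" "continuous_on {0..} v"
    using du dv by (auto simp: continuous_on_eq_continuous_within intro: DERIV_continuous)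
  have "continuous_on {0..} (\<lambda>s. ratio_Q (u s) (v s) * ratio_R (u s) (v s))"
    unfolding ratio_Q_def ratio_R_def by (intro continuous_intros cu)
  then obtain G where G: "G 0 = 0"
    "\<forall>s\<ge>0. (G has_real_derivative ratio_Q (u s) (v s) * ratio_R (u s) (v s)) (at s within {0..})"
    by (rule antiderivative_atLeast)
  \<comment> \<open>With the ratios known, the equation for \<open>a\<close> is linear and solved by
    quadrature, so positivity is immediate.\<close>
  define a where "a s = A0 * exp (G s)" for s
  have da: "(a has_real_derivative a s * (ratio_Q (u s) (v s) * ratio_R (u s) (v s))) (at s within {0..})" if "s \<ge> 0" for s
    unfolding a_def[abs_def] by (rule derivative_eq_intros G(2)[rule_format, OF that] refl)+ simp
  have ca: "continuous_on {0..} a"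
    using da by (auto simp: continuous_on_eq_continuous_within intro: DERIV_continuous)
  have "continuous_on {0..} (\<lambda>s. (a s)\<^sup>2 * (u s)\<^sup>2 * (v s)\<^sup>2 / 2)" by (intro continuous_intros cu ca) auto
  then obtain \<tau> where \<tau>: "\<tau> 0 = 0"
    "\<forall>s\<ge>0. (\<tau> has_real_derivative (a s)\<^sup>2 * (u s)\<^sup>2 * (v s)\<^sup>2 / 2) (at s within {0..})"
    by (rule antiderivative_atLeast)
  have "xcf_parametrization A0 B0 C0 u v a \<tau>"
    by unfold_locales
      (use uv du dv r da \<tau> G assms in \<open>auto simp: a_def\<close>)
  then show thesis by (rule that)
qed

section \<open>Reparametrization and uniqueness\<close>

text \<open>Since \<open>f\<close> undoes \<open>g\<close> on \<open>J\<close>, distinct points have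
  distinct images under \<open>g\<close>; hence \<open>g\<close> can be substituted into the
  difference quotient of \<open>f\<close>, also for one-sided derivatives.\<close>

lemma has_real_derivative_inverse_within:
  fixes f g :: "real \<Rightarrow> real"
  assumes d: "(f has_real_derivative D) (at (g t) within S)" and "D \<noteq> 0"
    and cont: "continuous (at t within J) g" and "t \<in> J"
    and g: "\<And>x. x \<in> J \<Longrightarrow> g x \<in> S \<and> f (g x) = x"
  shows "(g has_real_derivative 1 / D) (at t within J)"
proof -
  have "filterlim g (at (g t) within S) (at t within J)"
    unfolding filterlim_at
  proof
    show "\<forall>\<^sub>F x in at t within J. g x \<in> S \<and> g x \<noteq> g t"
      unfolding eventually_at_filter using g \<open>t \<in> J\<close> by (auto intro!: always_eventually) metis
    show "(g \<longlongrightarrow> g t) (at t within J)" using cont by (simp add: continuous_within)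
  qed
  from filterlim_compose[OF d[unfolded has_field_derivative_iff] this]
  have "((\<lambda>x. (f (g x) - f (g t)) / (g x - g t)) \<longlongrightarrow> D) (at t within J)" .
  from tendsto_inverse[OF this \<open>D \<noteq> 0\<close>]
  have "((\<lambda>x. (g x - g t) / (x - t)) \<longlongrightarrow> 1 / D) (at t within J)"
    unfolding inverse_eq_divide
    by (rule Lim_transform_eventually) (use g \<open>t \<in> J\<close> in \<open>auto simp: eventually_at_filter intro!: always_eventually\<close>)
  then show ?thesis by (simp add: has_field_derivative_iff)
qed

lemma time_interval_mono: "t \<in> time_interval T \<Longrightarrow> 0 \<le> s \<Longrightarrow> s \<le> t \<Longrightarrow> s \<in> time_interval T"
  unfolding time_interval_def using le_less_trans[of "ereal s" "ereal t" T] by auto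

text \<open>A strictly increasing \<open>\<tau>\<close> maps the half-line bijectively onto the
  nonnegative times below its limit; a limit in \<open>ereal\<close> treats finite and infinite
  lifetimes together. The last conclusion makes \<open>\<sigma>\<close> tend to infinity towards the
  end of the lifetime.\<close>

lemma reparametrize:
  fixes \<tau> D :: "real \<Rightarrow> real" and T :: ereal
  assumes \<tau>0: "\<tau> 0 = 0" and d: "\<And>s. s \<ge> 0 \<Longrightarrow> (\<tau> has_real_derivative D s) (at s within {0..})"
    and D: "\<And>s. s \<ge> 0 \<Longrightarrow> D s > 0" and lim: "((\<lambda>s. ereal (\<tau> s)) \<longlongrightarrow> T) at_top"
  obtains \<sigma> where "\<forall>s\<ge>0. \<tau> s \<in> time_interval T \<and> \<sigma> (\<tau> s) = s"
    "\<forall>t\<in>time_interval T. \<sigma> t \<ge> 0 \<and> \<tau> (\<sigma> t) = t \<and>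
       (\<sigma> has_real_derivative 1 / D (\<sigma> t)) (at t within time_interval T)"
    "\<forall>s t. 0 \<le> s \<and> t \<in> time_interval T \<and> \<tau> s \<le> t \<longrightarrow> s \<le> \<sigma> t"
proof -
  have sm: "\<tau> s < \<tau> s'" if "0 \<le> s" "s < s'" for s s'
    by (rule strict_mono_within_interval[of s s' "{0..}" \<tau> D]) (use that d D in auto)
  have m: "\<tau> s \<le> \<tau> s'" if "0 \<le> s" "s \<le> s'" for s s'
    using sm[of s s'] that by (cases "s = s'") auto
  have cont: "continuous_on {0..} \<tau>"
    using d by (auto simp: continuous_on_eq_continuous_within intro: DERIV_continuous)
  have lt: "ereal (\<tau> s) < T" if "s \<ge> 0" for s
  proof -
    \<comment> \<open>The detour through \<open>s + 1\<close> makes the comparison with the limit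
      strict.\<close>
    have "ereal (\<tau> s) < ereal (\<tau> (s + 1))" using sm[of s "s+1"] that by simp
    also have "\<dots> \<le> T"
    proof (rule tendsto_lowerbound[OF lim])
      show "\<forall>\<^sub>F x in at_top. ereal (\<tau> (s + 1)) \<le> ereal (\<tau> x)"
        using eventually_ge_at_top[of "s + 1"] by eventually_elim (use m that in auto)
    qed simp
    finally show ?thesis .
  qed
  have mem: "\<tau> s \<in> time_interval T" if "s \<ge> 0" for s
    using lt[OF that] m[of 0 s] that \<tau>0 by (simp add: time_interval_def)
  have ex: "\<exists>s\<ge>0. \<tau> s = t" if "t \<in> time_interval T" for t
  proof -
    have t: "0 \<le> t" "ereal t < T" using that by (auto simp: time_interval_def)
    have "\<forall>\<^sub>F s in at_top. ereal t < ereal (\<tau> s) \<and> s \<ge> 0"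
      using order_tendstoD(1)[OF lim t(2)] eventually_ge_at_top[of 0] by eventually_elim auto
    then obtain s where s: "t < \<tau> s" "s \<ge> 0" by (auto simp: eventually_at_top_linorder)
    have "continuous_on {0..s} \<tau>" by (rule continuous_on_subset[OF cont]) auto
    then show ?thesis using IVT'[of \<tau> 0 t s] s t \<tau>0 by force
  qed
  define \<sigma> where "\<sigma> t = (SOME s. s \<ge> 0 \<and> \<tau> s = t)" for t
  have \<sigma>: "\<sigma> t \<ge> 0" "\<tau> (\<sigma> t) = t" if "t \<in> time_interval T" for t
    using someI_ex[OF ex[OF that, unfolded]] unfolding \<sigma>_def by auto
  have le: "s \<le> \<sigma> t" if "0 \<le> s" "t \<in> time_interval T" "\<tau> s \<le> t" for s t
    using sm[of "\<sigma> t" s] \<sigma>[OF that(2)] that by force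
  have inv: "\<sigma> (\<tau> s) = s" if "s \<ge> 0" for s
    using \<sigma>[OF mem[OF that]] sm[of s "\<sigma> (\<tau> s)"] sm[of "\<sigma> (\<tau> s)" s] that by (metis linorder_neqE_linordered_idom less_irrefl)
  have "continuous (at t within time_interval T) \<sigma>" if t: "t \<in> time_interval T" for t
  proof -
    \<comment> \<open>The inverse is continuous on the image of a compact interval. The extra 1
      keeps \<open>t\<close> below the right endpoint, so that restricting to this image does not
      change the filter at \<open>t\<close>.\<close>
    define s1 where "s1 = \<sigma> t + 1"
    have s1: "s1 \<ge> 0" "t < \<tau> s1" unfolding s1_def using \<sigma>[OF t] sm[of "\<sigma> t" "\<sigma> t + 1"] by auto
    have "continuous_on (\<tau> ` {0..s1}) \<sigma>"
      by (rule continuous_on_inv) (use cont inv in \<open>auto intro: continuous_on_subset\<close>)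
    moreover have "\<tau> ` {0..s1} = {0..\<tau> s1}"
    proof
      show "\<tau> ` {0..s1} \<subseteq> {0..\<tau> s1}" using m \<tau>0 by force
      show "{0..\<tau> s1} \<subseteq> \<tau> ` {0..s1}"
      proof
        fix x assume x: "x \<in> {0..\<tau> s1}"
        then have "x \<in> time_interval T" using time_interval_mono[OF mem[OF s1(1)]] by simp
        note this \<sigma>[OF this]
        moreover have "\<sigma> x \<le> s1" using sm[of s1 "\<sigma> x"] s1 \<sigma>(2)[OF \<open>x \<in> time_interval T\<close>] x by force
        ultimately show "x \<in> \<tau> ` {0..s1}" by force
      qed
    qed
    moreover have "t \<in> {0..\<tau> s1}" using t s1 by (simp add: time_interval_def)
    ultimately have "continuous (at t within {0..\<tau> s1}) \<sigma>"
      by (simp add: continuous_on_eq_continuous_within)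
    moreover have "at t within {0..\<tau> s1} = at t within time_interval T"
      by (rule at_within_nhd[of _ "{..<\<tau> s1}"])
        (use s1 mem[OF s1(1)] time_interval_mono[OF mem[OF s1(1)]] in \<open>auto simp: time_interval_def\<close>)
    ultimately show ?thesis by simp
  qed
  then have "(\<sigma> has_real_derivative 1 / D (\<sigma> t)) (at t within time_interval T)" if t: "t \<in> time_interval T" for t
    by (intro has_real_derivative_inverse_within[where f = \<tau> and S = "{0..}"])
      (use d D \<sigma> that in \<open>auto simp: less_imp_neq[symmetric]\<close>)
  then show thesis
    by (intro that[of \<sigma>]) (use mem inv \<sigma> le in auto)
qed

context xcf_parametrization
begin

lemma u_pos: "s \<ge> 0 \<Longrightarrow> u s > 0"
  using v_pos v_le_u less_le_trans by blast

lemma diag_xcf_solution_reparametrized: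
  assumes lim: "((\<lambda>s. ereal (\<tau> s)) \<longlongrightarrow> T) at_top"
  obtains \<sigma> where "\<forall>s\<ge>0. \<tau> s \<in> time_interval T \<and> \<sigma> (\<tau> s) = s"
    "\<forall>t\<in>time_interval T. \<sigma> t \<ge> 0 \<and> \<tau> (\<sigma> t) = t"
    "\<forall>s t. 0 \<le> s \<and> t \<in> time_interval T \<and> \<tau> s \<le> t \<longrightarrow> s \<le> \<sigma> t"
    "diag_xcf_solution A0 B0 C0 T (\<lambda>t. a (\<sigma> t)) (\<lambda>t. u (\<sigma> t) * a (\<sigma> t)) (\<lambda>t. v (\<sigma> t) * a (\<sigma> t))"
proof -
  let ?D = "\<lambda>s. (a s)\<^sup>2 * (u s)\<^sup>2 * (v s)\<^sup>2 / 2"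
  have Dpos: "?D s > 0" if "s \<ge> 0" for s
    using a_pos[OF that] u_pos[OF that] v_pos[OF that] by simp
  obtain \<sigma> where \<sigma>: "\<forall>s\<ge>0. \<tau> s \<in> time_interval T \<and> \<sigma> (\<tau> s) = s"
    "\<forall>t\<in>time_interval T. \<sigma> t \<ge> 0 \<and> \<tau> (\<sigma> t) = t \<and>
       (\<sigma> has_real_derivative 1 / ?D (\<sigma> t)) (at t within time_interval T)"
    "\<forall>s t. 0 \<le> s \<and> t \<in> time_interval T \<and> \<tau> s \<le> t \<longrightarrow> s \<le> \<sigma> t"
    using reparametrize[OF \<tau>0 d\<tau> Dpos lim] by blast
  let ?J = "time_interval T"
  have chain: "((\<lambda>t. f (\<sigma> t)) has_real_derivative f' / ?D (\<sigma> t)) (at t within ?J)"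
    if t: "t \<in> ?J" and f: "(f has_real_derivative f') (at (\<sigma> t) within {0..})" for f f' t
  proof -
    have "(f has_real_derivative f') (at (\<sigma> t) within \<sigma> ` ?J)"
      by (rule has_field_derivative_subset[OF f]) (use \<sigma>(2) in auto)
    from DERIV_image_chain[OF this \<sigma>(2)[rule_format, OF t, THEN conjunct2, THEN conjunct2]]
    show ?thesis by (simp add: o_def)
  qed
  have "positive_xcf_on ?J (\<lambda>t. diag_metric (a (\<sigma> t)) (u (\<sigma> t) * a (\<sigma> t)) (v (\<sigma> t) * a (\<sigma> t)))"
    unfolding positive_xcf_on_diag
  proof (intro ballI conjI)
    fix t assume t: "t \<in> ?J"
    define s where "s = \<sigma> t"
    have s: "s \<ge> 0" using \<sigma>(2) t by (simp add: s_def)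
    note pos = a_pos[OF s] u_pos[OF s] v_pos[OF s]
    show "a (\<sigma> t) > 0" "u (\<sigma> t) * a (\<sigma> t) > 0" "v (\<sigma> t) * a (\<sigma> t) > 0"
      using pos by (auto simp: s_def)
    let ?P = "ratio_P (u s) (v s)" and ?Q = "ratio_Q (u s) (v s)" and ?R = "ratio_R (u s) (v s)"
    \<comment> \<open>Curvature is homogeneous of degree -1 in the metric, so a single power of
      \<open>a\<close> splits off and only the ratio polynomials remain.\<close>
    have k: "milnor_curv (a s) (u s * a s) (v s * a s) = - ?P / (a s * u s * v s)"
      "milnor_curv (u s * a s) (v s * a s) (a s) = - ?Q / (a s * u s * v s)"
      "milnor_curv (v s * a s) (a s) (u s * a s) = - ?R / (a s * u s * v s)"
      unfolding milnor_curv_def ratio_P_def ratio_Q_def ratio_R_def using pos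
      by (simp_all add: divide_simps power2_eq_square) algebra+
    have 1: "((\<lambda>t. a (\<sigma> t)) has_real_derivative a s * (?Q * ?R) / ?D s) (at t within ?J)"
      using chain[OF t, folded s_def, OF da[OF s]] by (simp add: s_def)
    have 2: "((\<lambda>t. u (\<sigma> t) * a (\<sigma> t)) has_real_derivative u s * a s * (?R * ?P) / ?D s) (at t within ?J)"
      using chain[OF t, folded s_def, OF DERIV_mult[OF du[OF s] da[OF s]]]
      by (simp add: s_def algebra_simps)
    have 3: "((\<lambda>t. v (\<sigma> t) * a (\<sigma> t)) has_real_derivative v s * a s * (?P * ?Q) / ?D s) (at t within ?J)"
      using chain[OF t, folded s_def, OF DERIV_mult[OF dv[OF s] da[OF s]]]
      by (simp add: s_def algebra_simps)
    \<comment> \<open>The density of \<open>t\<close> is chosen to absorb the factor 2 and the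
      squared denominator of a product of two curvatures.\<close>
    have e: "2 * (r * (- x / (a s * u s * v s) * (- y / (a s * u s * v s)))) = r * (x * y) / ?D s" for r x y
      using pos by (simp add: field_simps power2_eq_square)
    show "((\<lambda>t. a (\<sigma> t)) has_real_derivative
        2 * (a (\<sigma> t) * (milnor_curv (u (\<sigma> t) * a (\<sigma> t)) (v (\<sigma> t) * a (\<sigma> t)) (a (\<sigma> t)) *
          milnor_curv (v (\<sigma> t) * a (\<sigma> t)) (a (\<sigma> t)) (u (\<sigma> t) * a (\<sigma> t))))) (at t within ?J)"
      using 1 unfolding s_def[symmetric] k e .
    show "((\<lambda>t. u (\<sigma> t) * a (\<sigma> t)) has_real_derivative
        2 * (u (\<sigma> t) * a (\<sigma> t) * (milnor_curv (v (\<sigma> t) * a (\<sigma> t)) (a (\<sigma> t)) (u (\<sigma> t) * a (\<sigma> t)) *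
          milnor_curv (a (\<sigma> t)) (u (\<sigma> t) * a (\<sigma> t)) (v (\<sigma> t) * a (\<sigma> t))))) (at t within ?J)"
      using 2 unfolding s_def[symmetric] k e .
    show "((\<lambda>t. v (\<sigma> t) * a (\<sigma> t)) has_real_derivative
        2 * (v (\<sigma> t) * a (\<sigma> t) * (milnor_curv (a (\<sigma> t)) (u (\<sigma> t) * a (\<sigma> t)) (v (\<sigma> t) * a (\<sigma> t)) *
          milnor_curv (u (\<sigma> t) * a (\<sigma> t)) (v (\<sigma> t) * a (\<sigma> t)) (a (\<sigma> t))))) (at t within ?J)"
      using 3 unfolding s_def[symmetric] k e .
  qed
  moreover have "0 < T" "\<sigma> 0 = 0"
  proof -
    show "0 < T" using \<sigma>(1)[rule_format, of 0] \<tau>0 by (simp add: time_interval_def zero_ereal_def)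
    show "\<sigma> 0 = 0" using \<sigma>(1)[rule_format, of 0] \<tau>0 by simp
  qed
  ultimately show thesis
    using \<sigma> A0_pos a0 u0 v0 by (intro that[of \<sigma>]) (auto simp: diag_xcf_solution_def)
qed

end

section \<open>Uniqueness and maximality\<close>

lemma jointly_lipschitz_coordinate:
  assumes "\<And>x. x \<in> S \<Longrightarrow> \<bar>f x - g x\<bar> \<le> d x" "\<And>x. x \<in> S \<Longrightarrow> 0 < f x \<and> f x \<le> M" "\<And>x. x \<in> S \<Longrightarrow> 0 < g x \<and> g x \<le> M"
  shows "jointly_lipschitz S d f g"
  unfolding jointly_lipschitz_def
  by (rule exI[of _ 1], rule exI[of _ M]) (use assms in \<open>force simp: abs_of_pos\<close>)

lemma pos_continuous_bounds:
  fixes f :: "real \<Rightarrow> real"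
  assumes "continuous_on {0..b} f" "0 \<le> b" "\<And>t. t \<in> {0..b} \<Longrightarrow> f t > 0"
  obtains m M where "m > 0" "\<forall>t\<in>{0..b}. m \<le> f t \<and> f t \<le> M"
proof -
  obtain x where "x \<in> {0..b}" "\<forall>t\<in>{0..b}. f x \<le> f t"
    using continuous_attains_inf[OF _ _ assms(1)] assms(2) by force
  moreover obtain y where "y \<in> {0..b}" "\<forall>t\<in>{0..b}. f t \<le> f y"
    using continuous_attains_sup[OF _ _ assms(1)] assms(2) by force
  ultimately show thesis using that[of "f x" "f y"] assms(3) by blast
qed

text \<open>On a closed interval both solutions stay in a compact part of the positive octant. There
  the rational vector field is Lipschitz, and Gronwall applies to their distance.\<close>

lemma diag_xcf_solution_unique:
  assumes s1: "diag_xcf_solution A0 B0 C0 T A B C" and s2: "diag_xcf_solution A0 B0 C0 T' A' B' C'"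
    and b: "b \<in> time_interval T" "b \<in> time_interval T'"
  shows "A b = A' b" "B b = B' b" "C b = C' b"
proof -
  let ?S = "{0..b}"
  \<comment> \<open>The system is cyclically symmetric: rotating the arguments of \<open>?F\<close>
    yields the other two components.\<close>
  let ?F = "\<lambda>A B C t :: real. 2 * (A t * (milnor_curv (B t) (C t) (A t) * milnor_curv (C t) (A t) (B t)))"
  have b0: "b \<ge> 0" using b by (simp add: time_interval_def)
  have sub: "?S \<subseteq> time_interval T" "?S \<subseteq> time_interval T'"
    using b time_interval_mono by auto
  have sol: "(\<forall>t\<in>?S. A t > 0 \<and> B t > 0 \<and> C t > 0 \<and> (A has_real_derivative ?F A B C t) (at t within ?S) \<and>
      (B has_real_derivative ?F B C A t) (at t within ?S) \<and> (C has_real_derivative ?F C A B t) (at t within ?S))"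
    if "diag_xcf_solution A0 B0 C0 T A B C" "?S \<subseteq> time_interval T" for T A B C
    using that unfolding diag_xcf_solution_def positive_xcf_on_diag
    by (meson has_field_derivative_subset subset_iff)
  note d = sol[OF s1 sub(1)] and d' = sol[OF s2 sub(2)]
  have bounds: "\<exists>m M. m > 0 \<and> (\<forall>t\<in>?S. m \<le> A t \<and> A t \<le> M \<and> m \<le> B t \<and> B t \<le> M \<and> m \<le> C t \<and> C t \<le> M)"
    if d: "(\<forall>t\<in>?S. A t > 0 \<and> B t > 0 \<and> C t > 0 \<and> (A has_real_derivative ?F A B C t) (at t within ?S) \<and>
      (B has_real_derivative ?F B C A t) (at t within ?S) \<and> (C has_real_derivative ?F C A B t) (at t within ?S))" for A B C
  proof -
    have c: "continuous_on ?S A" "continuous_on ?S B" "continuous_on ?S C"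
      using d by (auto simp: continuous_on_eq_continuous_within intro: DERIV_continuous)
    obtain m1 M1 where 1: "m1 > 0" "\<forall>t\<in>?S. m1 \<le> A t \<and> A t \<le> M1"
      by (rule pos_continuous_bounds[OF c(1) b0]) (use d in auto)
    obtain m2 M2 where 2: "m2 > 0" "\<forall>t\<in>?S. m2 \<le> B t \<and> B t \<le> M2"
      by (rule pos_continuous_bounds[OF c(2) b0]) (use d in auto)
    obtain m3 M3 where 3: "m3 > 0" "\<forall>t\<in>?S. m3 \<le> C t \<and> C t \<le> M3"
      by (rule pos_continuous_bounds[OF c(3) b0]) (use d in auto)
    show ?thesis
      by (rule exI[of _ "min m1 (min m2 m3)"], rule exI[of _ "max M1 (max M2 M3)"])
        (use 1 2 3 in \<open>auto simp: min_le_iff_disj le_max_iff_disj\<close>)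
  qed
  obtain m M where m: "m > 0" "\<forall>t\<in>?S. m \<le> A t \<and> A t \<le> M \<and> m \<le> B t \<and> B t \<le> M \<and> m \<le> C t \<and> C t \<le> M"
    using bounds[OF d] by blast
  obtain m' M' where m': "m' > 0" "\<forall>t\<in>?S. m' \<le> A' t \<and> A' t \<le> M' \<and> m' \<le> B' t \<and> B' t \<le> M' \<and> m' \<le> C' t \<and> C' t \<le> M'"
    using bounds[OF d'] by blast
  define r where "r = min m m'"
  have r: "r > 0" using m m' by (simp add: r_def)
  have rb: "A t \<ge> r \<and> A' t \<ge> r" "B t \<ge> r \<and> B' t \<ge> r" "C t \<ge> r \<and> C' t \<ge> r" if "t \<in> ?S" for t
    using m m' that by (auto simp: r_def min_le_iff_disj)
  define \<delta> where "\<delta> t = \<bar>A t - A' t\<bar> + \<bar>B t - B' t\<bar> + \<bar>C t - C' t\<bar>" for t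
  have \<delta>: "\<delta> t \<ge> 0" for t by (simp add: \<delta>_def)
  have j: "jointly_lipschitz ?S \<delta> A A'" "jointly_lipschitz ?S \<delta> B B'" "jointly_lipschitz ?S \<delta> C C'"
    by (rule jointly_lipschitz_coordinate[of _ _ _ _ "max M M'"];
        use m m' d d' in \<open>auto simp: \<delta>_def le_max_iff_disj\<close>)+
  have F: "jointly_lipschitz ?S \<delta> (?F A B C) (?F A' B' C')"
    if j: "jointly_lipschitz ?S \<delta> A A'" "jointly_lipschitz ?S \<delta> B B'" "jointly_lipschitz ?S \<delta> C C'"
      and rb: "\<And>t. t \<in> ?S \<Longrightarrow> A t \<ge> r \<and> A' t \<ge> r" "\<And>t. t \<in> ?S \<Longrightarrow> B t \<ge> r \<and> B' t \<ge> r"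
        "\<And>t. t \<in> ?S \<Longrightarrow> C t \<ge> r \<and> C' t \<ge> r" for A B C A' B' C'
    unfolding milnor_curv_def power2_eq_square divide_inverse inverse_mult_distrib
    by (intro jointly_lipschitz_add jointly_lipschitz_diff jointly_lipschitz_mult jointly_lipschitz_const \<delta> j
      jointly_lipschitz_inverse[OF \<delta> j(1) r rb(1)] jointly_lipschitz_inverse[OF \<delta> j(2) r rb(2)]
      jointly_lipschitz_inverse[OF \<delta> j(3) r rb(3)])
  obtain L1 M1 where L1: "L1 \<ge> 0" "M1 \<ge> 0" "\<forall>t\<in>?S. \<bar>?F A B C t - ?F A' B' C' t\<bar> \<le> L1 * \<delta> t \<and> \<bar>?F A B C t\<bar> \<le> M1 \<and> \<bar>?F A' B' C' t\<bar> \<le> M1"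
    by (rule jointly_lipschitzE[OF F[OF j rb] \<delta>])
  obtain L2 M2 where L2: "L2 \<ge> 0" "M2 \<ge> 0" "\<forall>t\<in>?S. \<bar>?F B C A t - ?F B' C' A' t\<bar> \<le> L2 * \<delta> t \<and> \<bar>?F B C A t\<bar> \<le> M2 \<and> \<bar>?F B' C' A' t\<bar> \<le> M2"
    by (rule jointly_lipschitzE[OF F[OF j(2,3,1) rb(2,3,1)] \<delta>])
  obtain L3 M3 where L3: "L3 \<ge> 0" "M3 \<ge> 0" "\<forall>t\<in>?S. \<bar>?F C A B t - ?F C' A' B' t\<bar> \<le> L3 * \<delta> t \<and> \<bar>?F C A B t\<bar> \<le> M3 \<and> \<bar>?F C' A' B' t\<bar> \<le> M3"
    by (rule jointly_lipschitzE[OF F[OF j(3,1,2) rb(3,1,2)] \<delta>])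
  \<comment> \<open>The Lipschitz estimates use the sum \<open>\<delta>\<close> of absolute values,
    but Gronwall needs a differentiable quantity; the two are linked by
    \<open>(\<delta> t)\<^sup>2 \<le> 3 * E t\<close>.\<close>
  define E where "E t = (A t - A' t)\<^sup>2 + (B t - B' t)\<^sup>2 + (C t - C' t)\<^sup>2" for t
  define E' where "E' t = 2 * ((A t - A' t) * (?F A B C t - ?F A' B' C' t) + (B t - B' t) * (?F B C A t - ?F B' C' A' t)
     + (C t - C' t) * (?F C A B t - ?F C' A' B' t))" for t
  have dE: "(E has_real_derivative E' t) (at t within ?S)" if "t \<in> ?S" for t
  proof -
    have dd: "(A has_real_derivative ?F A B C t) (at t within ?S)" "(B has_real_derivative ?F B C A t) (at t within ?S)"
      "(C has_real_derivative ?F C A B t) (at t within ?S)"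
      "(A' has_real_derivative ?F A' B' C' t) (at t within ?S)" "(B' has_real_derivative ?F B' C' A' t) (at t within ?S)"
      "(C' has_real_derivative ?F C' A' B' t) (at t within ?S)"
      using d d' that by blast+
    have sq: "((\<lambda>t. (f t - g t)\<^sup>2) has_real_derivative 2 * ((f t - g t) * (x - y))) (at t within ?S)"
      if "(f has_real_derivative x) (at t within ?S)" "(g has_real_derivative y) (at t within ?S)" for f g x y
      by (rule derivative_eq_intros that refl)+ simp
    show ?thesis
      unfolding E_def[abs_def] E'_def distrib_left
      by (intro DERIV_add sq dd)
  qed
  have le: "E' t \<le> (6 * (L1 + L2 + L3)) * E t" if "t \<in> ?S" for t
  proof -
    have *: "x * y \<le> (L1 + L2 + L3) * (\<bar>x\<bar> * \<delta> t)" if "\<bar>y\<bar> \<le> L * \<delta> t" "L \<le> L1 + L2 + L3" for x y L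
    proof -
      have "\<bar>y\<bar> \<le> (L1 + L2 + L3) * \<delta> t" using that \<delta>[of t] by (meson mult_right_mono order_trans)
      then have "\<bar>x\<bar> * \<bar>y\<bar> \<le> \<bar>x\<bar> * ((L1 + L2 + L3) * \<delta> t)" by (rule mult_left_mono) simp
      then show ?thesis by (simp add: mult_ac flip: abs_mult) 
    qed
    have "E' t \<le> 2 * ((L1 + L2 + L3) * (\<bar>A t - A' t\<bar> * \<delta> t) + (L1 + L2 + L3) * (\<bar>B t - B' t\<bar> * \<delta> t)
        + (L1 + L2 + L3) * (\<bar>C t - C' t\<bar> * \<delta> t))"
      unfolding E'_def
      by (intro mult_left_mono add_mono *) (use L1 L2 L3 that in auto)
    also have "\<dots> = 2 * ((L1 + L2 + L3) * (\<delta> t)\<^sup>2)"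
      by (simp add: \<delta>_def power2_eq_square algebra_simps)
    also have "\<dots> \<le> 2 * ((L1 + L2 + L3) * (3 * E t))"
    proof (intro mult_left_mono)
      have "(x + y + z)\<^sup>2 \<le> 3 * (x\<^sup>2 + y\<^sup>2 + z\<^sup>2)" for x y z :: real
        using zero_le_power2[of "x - y"] zero_le_power2[of "y - z"] zero_le_power2[of "z - x"]
        by (simp add: power2_eq_square algebra_simps)
      from this[of "\<bar>A t - A' t\<bar>" "\<bar>B t - B' t\<bar>" "\<bar>C t - C' t\<bar>"]
      show "(\<delta> t)\<^sup>2 \<le> 3 * E t" by (simp add: \<delta>_def E_def)
    qed (use L1 L2 L3 in auto)
    finally show ?thesis by (simp add: algebra_simps)
  qed
  have "E b \<le> E 0 * exp (6 * (L1 + L2 + L3) * b)"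
    by (rule gronwall_upper[OF b0 order.refl dE le])
  moreover have "E 0 = 0" using s1 s2 by (simp add: E_def diag_xcf_solution_def)
  ultimately have "E b \<le> 0" by simp
  then have "(A b - A' b)\<^sup>2 = 0 \<and> (B b - B' b)\<^sup>2 = 0 \<and> (C b - C' b)\<^sup>2 = 0"
    unfolding E_def using zero_le_power2[of "A b - A' b"] zero_le_power2[of "B b - B' b"] zero_le_power2[of "C b - C' b"]
    by linarith
  then show "A b = A' b" "B b = B' b" "C b = C' b" by simp_all
qed

lemma maximal_diag_xcf_solution_infinite:
  assumes "diag_xcf_solution A0 B0 C0 \<infinity> A B C"
  shows "maximal_diag_xcf_solution A0 B0 C0 \<infinity> A B C"
  unfolding maximal_diag_xcf_solution_def
  using assms diag_xcf_solution_unique[OF _ assms]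
  by (auto simp: time_interval_def)

text \<open>A solution defined at \<open>\<theta>\<close> would have a continuous first coefficient
  there; by uniqueness that coefficient equals \<open>A\<close> before \<open>\<theta>\<close>,
  where \<open>A\<close> diverges.\<close>

lemma maximal_diag_xcf_solution_blowup:
  assumes sol: "diag_xcf_solution A0 B0 C0 (ereal \<theta>) A B C" and blow: "filterlim A at_top (at_left \<theta>)"
  shows "maximal_diag_xcf_solution A0 B0 C0 (ereal \<theta>) A B C"
  unfolding maximal_diag_xcf_solution_def
proof (intro conjI allI impI sol)
  fix T' A' B' C' assume s': "diag_xcf_solution A0 B0 C0 T' A' B' C'"
  have \<theta>: "\<theta> > 0" using sol by (simp add: diag_xcf_solution_def)
  show le: "T' \<le> ereal \<theta>"
  proof (rule ccontr)
    assume "\<not> T' \<le> ereal \<theta>"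
    then have mem: "\<theta> \<in> time_interval T'" using \<theta> by (simp add: time_interval_def)
    then have "continuous (at \<theta> within time_interval T') A'"
      using s' unfolding diag_xcf_solution_def positive_xcf_on_diag by (blast intro: DERIV_continuous)
    then have "continuous (at \<theta> within {0..\<theta>}) A'"
      by (rule continuous_within_subset) (use time_interval_mono[OF mem] in auto)
    then have "(A' \<longlongrightarrow> A' \<theta>) (at_left \<theta>)"
      using \<theta> by (simp add: continuous_within at_within_Icc_at_left)
    moreover have "\<forall>\<^sub>F t in at_left \<theta>. A' t = A t"
      using eventually_at_left_real[OF \<theta>]
      by eventually_elim (rule diag_xcf_solution_unique(1)[OF s' sol],
          use time_interval_mono[OF mem] in \<open>auto simp: time_interval_def\<close>)
    ultimately have "(A \<longlongrightarrow> A' \<theta>) (at_left \<theta>)" by (rule Lim_transform_eventually)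
    moreover have "at_left \<theta> \<noteq> bot" by simp
    ultimately show False using blow not_tendsto_and_filterlim_at_infinity filterlim_at_top_imp_at_infinity by blast
  qed
  show "\<forall>t\<in>time_interval T'. A' t = A t \<and> B' t = B t \<and> C' t = C t"
  proof
    fix t assume t: "t \<in> time_interval T'"
    then have "t \<in> time_interval (ereal \<theta>)"
      using less_le_trans[OF _ le, of "ereal t"] by (simp add: time_interval_def)
    then show "A' t = A t \<and> B' t = B t \<and> C' t = C t"
      using diag_xcf_solution_unique[OF s' sol t] by blast
  qed
qed

section \<open>Asymptotics\<close>

lemma diag_xcf_solution_round:
  assumes "A0 > 0"
  defines "w \<equiv> \<lambda>t. sqrt (A0\<^sup>2 + 4 * t)"
  shows "diag_xcf_solution A0 A0 A0 \<infinity> w w w"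
  unfolding diag_xcf_solution_def positive_xcf_on_diag
proof (intro conjI ballI)
  show "w 0 = A0" "w 0 = A0" "w 0 = A0" using assms by (simp_all add: w_def)
  fix t assume "t \<in> time_interval \<infinity>"
  then have p: "A0\<^sup>2 + 4 * t > 0" using assms by (simp add: time_interval_def add_pos_nonneg)
  then show wp: "w t > 0" "w t > 0" "w t > 0" by (simp_all add: w_def)
  \<comment> \<open>With equal curvatures \<open>1 / w\<close> the system collapses to
    \<open>w' = 2 / w\<close>, so \<open>w\<^sup>2\<close> grows at rate 4.\<close>
  have "milnor_curv (w t) (w t) (w t) = 1 / w t"
    using wp(1) by (simp add: milnor_curv_def field_simps power2_eq_square)
  moreover have "(w has_real_derivative 2 / w t) (at t within J)" for J
    unfolding w_def using p by (auto intro!: derivative_eq_intros simp: divide_simps)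
  ultimately have "(w has_real_derivative
      2 * (w t * (milnor_curv (w t) (w t) (w t) * milnor_curv (w t) (w t) (w t)))) (at t within J)" for J
    using wp(1) by simp
  then show "(w has_real_derivative
      2 * (w t * (milnor_curv (w t) (w t) (w t) * milnor_curv (w t) (w t) (w t)))) (at t within time_interval \<infinity>)"
    "(w has_real_derivative
      2 * (w t * (milnor_curv (w t) (w t) (w t) * milnor_curv (w t) (w t) (w t)))) (at t within time_interval \<infinity>)"
    "(w has_real_derivative
      2 * (w t * (milnor_curv (w t) (w t) (w t) * milnor_curv (w t) (w t) (w t)))) (at t within time_interval \<infinity>)"
    by blast+
qed simp

lemma cube_powr_third: "x > 0 \<Longrightarrow> (x ^ 3) powr (1/3) = (x::real)"
  by (simp add: powr_powr flip: powr_numeral)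

context xcf_parametrization
begin

lemma eventually_v_pos: "\<forall>\<^sub>F s in at_top. v s > 0"
  using eventually_ge_at_top[of 0] by eventually_elim (rule v_pos)

lemma at_within_atLeast: "s > 0 \<Longrightarrow> at s within {0..} = at (s::real)"
  by (rule at_within_interior) simp

section \<open>The case \<open>A = B > C\<close>\<close>

context
  assumes two: "B0 = A0" "C0 < A0"
begin

text \<open>For \<open>u = 1\<close> the polynomials become \<open>P = Q = - v\<^sup>2\<close> and
  \<open>R = v * (3 * v - 4)\<close>.\<close>

lemma dv_two: "s \<ge> 0 \<Longrightarrow> (v has_real_derivative - 4 * v s ^ 4 * (1 - v s)) (at s within {0..})"
proof -
  assume s: "s \<ge> 0"
  have "v s * ratio_Q (u s) (v s) * (ratio_P (u s) (v s) - ratio_R (u s) (v s)) = - 4 * v s ^ 4 * (1 - v s)"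
    unfolding u_eq_1[OF two(1) s] ratio_P_def ratio_Q_def ratio_R_def
    by (simp add: eval_nat_numeral algebra_simps)
  then show ?thesis using dv[OF s] by simp
qed

lemma da_two: "s \<ge> 0 \<Longrightarrow> (a has_real_derivative a s * (v s ^ 3 * (4 - 3 * v s))) (at s within {0..})"
proof -
  assume s: "s \<ge> 0"
  have "ratio_Q (u s) (v s) * ratio_R (u s) (v s) = v s ^ 3 * (4 - 3 * v s)"
    unfolding u_eq_1[OF two(1) s] ratio_P_def ratio_Q_def ratio_R_def
    by (simp add: eval_nat_numeral algebra_simps)
  then show ?thesis using da[OF s] by simp
qed

lemma v0_less_1: "v 0 < 1"
  using v_less_1[OF two(2), of 0] by simp

lemma v_decreasing_two: "s \<ge> 0 \<Longrightarrow> v s \<le> v 0"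
proof -
  assume s: "s \<ge> 0"
  have "- v 0 \<le> - v s"
  proof (rule mono_within_interval[OF s, of "{0..}"])
    fix x assume x: "x \<in> {0..s}"
    show "((\<lambda>x. - v x) has_real_derivative 4 * v x ^ 4 * (1 - v x)) (at x within {0..})"
      using x by (auto intro!: derivative_eq_intros dv_two)
    show "0 \<le> 4 * v x ^ 4 * (1 - v x)" using v_less_1[OF two(2), of x] x by simp
  qed auto
  then show ?thesis by simp
qed

text \<open>The power -3 turns the leading term \<open>- 4 * v ^ 4\<close> of the equation into the
  constant rate 12.\<close>

lemma inverse_v3_deriv:
  "s \<ge> 0 \<Longrightarrow> ((\<lambda>s. 1 / v s ^ 3) has_real_derivative 12 * (1 - v s)) (at s within {0..})"
proof -
  assume s: "s \<ge> 0"
  have p: "v s > 0" using v_pos[OF s] .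
  show ?thesis
    by (rule derivative_eq_intros dv_two[OF s] refl)+
      (use p in \<open>auto simp: divide_simps power_eq_if\<close>)
qed

lemma inverse_v3_at_top: "filterlim (\<lambda>s. 1 / v s ^ 3) at_top at_top"
proof (rule filterlim_at_top_mono)
  show "filterlim (\<lambda>s. (12 * (1 - v 0)) * s) at_top at_top"
    using v0_less_1 by (intro filterlim_tendsto_pos_mult_at_top[OF tendsto_const] filterlim_ident) simp
  show "\<forall>\<^sub>F s in at_top. (12 * (1 - v 0)) * s \<le> 1 / v s ^ 3"
    using eventually_ge_at_top[of 0]
  proof eventually_elim
    fix s :: real assume s: "0 \<le> s"
    have "1 / v 0 ^ 3 - 12 * (1 - v 0) * 0 \<le> 1 / v s ^ 3 - 12 * (1 - v 0) * s"
    proof (rule mono_within_interval[OF s, of "{0..}"])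
      fix x assume x: "x \<in> {0..s}"
      show "((\<lambda>x. 1 / v x ^ 3 - 12 * (1 - v 0) * x) has_real_derivative 12 * (1 - v x) - 12 * (1 - v 0)) (at x within {0..})"
        using DERIV_diff[OF inverse_v3_deriv[of x] DERIV_cmult[OF DERIV_ident, of "12 * (1 - v 0)"]] x by simp
      show "0 \<le> 12 * (1 - v x) - 12 * (1 - v 0)" using v_decreasing_two[of x] x by simp
    qed auto
    moreover have "1 / v 0 ^ 3 > 0" using v_pos[of 0] by simp
    ultimately show "(12 * (1 - v 0)) * s \<le> 1 / v s ^ 3" by linarith
  qed
qed

lemma v_tendsto_0_two: "(v \<longlongrightarrow> 0) at_top"
proof -
  have "((\<lambda>s. inverse (1 / v s ^ 3) powr (1/3)) \<longlongrightarrow> 0 powr (1/3)) at_top"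
    by (intro tendsto_powr' tendsto_inverse_0_at_top[OF inverse_v3_at_top] tendsto_const)
      (use eventually_v_pos in \<open>auto elim!: eventually_mono\<close>)
  moreover have "\<forall>\<^sub>F s in at_top. inverse (1 / v s ^ 3) powr (1/3) = v s"
    using eventually_ge_at_top[of 0]
  proof eventually_elim
    fix s :: real assume "0 \<le> s"
    then have "v s > 0" by (rule v_pos)
    then show "inverse (1 / v s ^ 3) powr (1/3) = v s" by (simp add: cube_powr_third)
  qed
  ultimately show ?thesis by (simp add: tendsto_cong)
qed

text \<open>The value that conservation of \<open>C ^ 4 / (1 - v)\<close> assigns to
  \<open>C\<close> at \<open>v = 0\<close>.\<close>

definition c_limit :: real where
  "c_limit = C0 / (1 - v 0) powr (1/4)"

lemma C0_pos: "C0 > 0"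
  using v_pos[of 0] v0 A0_pos by (simp add: zero_less_divide_iff)

lemma c_limit_pos: "c_limit > 0"
  using C0_pos v0_less_1 by (simp add: c_limit_def)

lemma c_eq: "s \<ge> 0 \<Longrightarrow> v s * a s = c_limit * (1 - v s) powr (1/4)"
proof -
  assume s: "s \<ge> 0"
  \<comment> \<open>The logarithmic derivatives are \<open>v ^ 4\<close> for \<open>C\<close> and
    \<open>4 * v ^ 4\<close> for \<open>1 - v\<close>, hence the weight 1/4.\<close>
  let ?f = "\<lambda>s. ln (v s * a s) - ln (1 - v s) / 4"
  have "(\<lambda>x. ?f x) s = ?f 0"
  proof -
    have d: "(?f has_real_derivative 0) (at x within {0..})" if x: "x \<in> {0..}" for x
    proof -
      have p: "v x > 0" "a x > 0" "v x < 1" using v_pos a_pos v_less_1[OF two(2)] x by auto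
      have "(?f has_real_derivative
         (1 / (v x * a x)) * ((- 4 * v x ^ 4 * (1 - v x)) * a x + (a x * (v x ^ 3 * (4 - 3 * v x))) * v x)
           - (1 / (1 - v x)) * (0 - (- 4 * v x ^ 4 * (1 - v x))) / 4) (at x within {0..})"
        using p x by (intro DERIV_diff DERIV_cdivide DERIV_chain2[OF DERIV_ln_divide] DERIV_mult dv_two da_two DERIV_const) auto
      also have "(1 / (v x * a x)) * ((- 4 * v x ^ 4 * (1 - v x)) * a x + (a x * (v x ^ 3 * (4 - 3 * v x))) * v x)
           - (1 / (1 - v x)) * (0 - (- 4 * v x ^ 4 * (1 - v x))) / 4 = 0"
        using p by (simp add: field_simps power_eq_if)
      finally show ?thesis .
    qed
    have "?f 0 \<le> ?f s" by (rule mono_within_interval[OF s, of "{0..}" _ "\<lambda>_. 0"]) (use d in auto)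
    moreover have "- ?f 0 \<le> - ?f s"
      by (rule mono_within_interval[OF s, of "{0..}" "\<lambda>x. - ?f x" "\<lambda>_. 0"])
        (use DERIV_minus[OF d] in auto)
    ultimately show ?thesis by simp
  qed
  moreover have "ln (c_limit * (1 - v s) powr (1/4)) = ln (v 0 * a 0) - ln (1 - v 0) / 4 + ln (1 - v s) / 4"
    unfolding c_limit_def using C0_pos v0_less_1 v_less_1[OF two(2) s] A0_pos
    by (simp add: ln_mult ln_div ln_powr v0 a0)
  ultimately have "ln (v s * a s) = ln (c_limit * (1 - v s) powr (1/4))" by simp
  then show ?thesis
    using v_pos[OF s] a_pos[OF s] c_limit_pos v_less_1[OF two(2) s] by (subst (asm) ln_inj_iff) auto
qed

lemma c_tendsto: "((\<lambda>s. v s * a s) \<longlongrightarrow> c_limit) at_top"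
proof -
  have "((\<lambda>s. c_limit * (1 - v s) powr (1/4)) \<longlongrightarrow> c_limit * (1 - 0) powr (1/4)) at_top"
    by (intro tendsto_intros v_tendsto_0_two) auto
  moreover have "\<forall>\<^sub>F s in at_top. c_limit * (1 - v s) powr (1/4) = v s * a s"
    using eventually_ge_at_top[of 0] by eventually_elim (simp add: c_eq)
  ultimately show ?thesis by (simp add: tendsto_cong)
qed

text \<open>As \<open>C\<close> is an explicit function of \<open>v\<close>, its first correction is
  the derivative of that function at \<open>v = 0\<close>.\<close>

lemma c_diff_tendsto: "((\<lambda>s. (v s * a s - c_limit) / v s) \<longlongrightarrow> - c_limit / 4) at_top"
proof -
  have "((\<lambda>x. c_limit * (1 - x) powr (1/4)) has_real_derivative - c_limit / 4) (at 0)"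
    by (auto intro!: derivative_eq_intros)
  then have *: "((\<lambda>x. (c_limit * (1 - x) powr (1/4) - c_limit) / x) \<longlongrightarrow> - c_limit / 4) (at 0)"
    by (simp add: has_field_derivative_iff)
  have "filterlim v (at 0) at_top"
    unfolding filterlim_at using v_tendsto_0_two eventually_v_pos
    by (auto elim!: eventually_mono)
  from filterlim_compose[OF * this]
  have "((\<lambda>s. (c_limit * (1 - v s) powr (1/4) - c_limit) / v s) \<longlongrightarrow> - c_limit / 4) at_top" .
  moreover have "\<forall>\<^sub>F s in at_top. (c_limit * (1 - v s) powr (1/4) - c_limit) / v s = (v s * a s - c_limit) / v s"
    using eventually_ge_at_top[of 0] by eventually_elim (simp add: c_eq)
  ultimately show ?thesis by (rule Lim_transform_eventually)
qed

text \<open>L'Hopital compares the density \<open>C\<^sup>2 / 2\<close> of time with the derivative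
  \<open>12 * (1 - v)\<close> of \<open>1 / v ^ 3\<close>; this is the origin of 24.\<close>

lemma \<tau>_v3_tendsto: "((\<lambda>s. \<tau> s * v s ^ 3) \<longlongrightarrow> c_limit\<^sup>2 / 24) at_top"
proof -
  have "((\<lambda>s. \<tau> s / (1 / v s ^ 3)) \<longlongrightarrow> c_limit\<^sup>2 / 24) at_top"
  proof (rule lhospital_at_top_at_top[OF inverse_v3_at_top])
    show "\<forall>\<^sub>F s in at_top. 12 * (1 - v s) \<noteq> 0"
      using eventually_ge_at_top[of 0] by eventually_elim (use v_less_1[OF two(2)] in force)
    show "\<forall>\<^sub>F s in at_top. (\<tau> has_real_derivative (v s * a s)\<^sup>2 / 2) (at s)"
      using eventually_gt_at_top[of 0]
    proof eventually_elim
      fix s :: real assume "0 < s"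
      then show "(\<tau> has_real_derivative (v s * a s)\<^sup>2 / 2) (at s)"
        using d\<tau>[of s] u_eq_1[OF two(1), of s] at_within_atLeast[of s]
        by (simp add: power_mult_distrib mult.commute)
    qed
    show "\<forall>\<^sub>F s in at_top. ((\<lambda>s. 1 / v s ^ 3) has_real_derivative 12 * (1 - v s)) (at s)"
      using eventually_gt_at_top[of 0]
    proof eventually_elim
      fix s :: real assume "0 < s"
      then show "((\<lambda>s. 1 / v s ^ 3) has_real_derivative 12 * (1 - v s)) (at s)"
        using inverse_v3_deriv[of s] at_within_atLeast[of s] by simp
    qed
    have "((\<lambda>s. (v s * a s)\<^sup>2 / 2 / (12 * (1 - v s))) \<longlongrightarrow> c_limit\<^sup>2 / 2 / (12 * (1 - 0))) at_top"
      by (intro tendsto_intros c_tendsto v_tendsto_0_two) simp_all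
    then show "((\<lambda>s. (v s * a s)\<^sup>2 / 2 / (12 * (1 - v s))) \<longlongrightarrow> c_limit\<^sup>2 / 24) at_top" by simp
  qed
  then show ?thesis by simp
qed

lemma \<tau>_at_top_two: "filterlim \<tau> at_top at_top"
proof -
  have "filterlim (\<lambda>s. \<tau> s * v s ^ 3 * (1 / v s ^ 3)) at_top at_top"
    by (rule filterlim_tendsto_pos_mult_at_top[OF \<tau>_v3_tendsto _ inverse_v3_at_top])
      (use c_limit_pos in simp)
  moreover have "\<forall>\<^sub>F s in at_top. \<tau> s * v s ^ 3 * (1 / v s ^ 3) = \<tau> s"
    using eventually_ge_at_top[of 0] by eventually_elim (use v_pos in force)
  ultimately show ?thesis by (simp add: filterlim_cong)
qed

text \<open>Multiplying numerator and denominator by \<open>v\<close> leaves only \<open>C\<close>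
  and \<open>\<tau> * v ^ 3\<close>, whose limits are known.\<close>

lemma a_ratio_tendsto_two: "((\<lambda>s. a s / (24 * c_limit * \<tau> s) powr (1/3)) \<longlongrightarrow> 1) at_top"
proof -
  have "((\<lambda>s. v s * a s / (24 * c_limit * (\<tau> s * v s ^ 3)) powr (1/3))
      \<longlongrightarrow> c_limit / (24 * c_limit * (c_limit\<^sup>2 / 24)) powr (1/3)) at_top"
    by (intro tendsto_intros c_tendsto \<tau>_v3_tendsto) (use c_limit_pos in auto)
  also have "c_limit / (24 * c_limit * (c_limit\<^sup>2 / 24)) powr (1/3) = 1"
  proof -
    have "24 * c_limit * (c_limit\<^sup>2 / 24) = c_limit ^ 3"
      by (simp add: power2_eq_square power3_eq_cube)
    then show ?thesis using c_limit_pos by (simp add: cube_powr_third)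
  qed
  finally have "((\<lambda>s. v s * a s / (24 * c_limit * (\<tau> s * v s ^ 3)) powr (1/3)) \<longlongrightarrow> 1) at_top" .
  moreover have "\<forall>\<^sub>F s in at_top. v s * a s / (24 * c_limit * (\<tau> s * v s ^ 3)) powr (1/3)
      = a s / (24 * c_limit * \<tau> s) powr (1/3)"
    using eventually_ge_at_top[of 0] filterlim_at_top_dense[THEN iffD1, rule_format, OF \<tau>_at_top_two, of 0]
  proof eventually_elim
    fix s :: real assume s: "0 \<le> s" "0 < \<tau> s"
    have v: "v s > 0" using v_pos[OF s(1)] .
    then have "(v s ^ 3) powr (1/3) = v s" by (simp add: cube_powr_third)
    moreover have "(24 * c_limit * (\<tau> s * v s ^ 3)) powr (1/3) = (24 * c_limit * \<tau> s) powr (1/3) * (v s ^ 3) powr (1/3)"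
      using s v c_limit_pos by (subst powr_mult[symmetric]) (auto simp: mult_ac)
    ultimately show "v s * a s / (24 * c_limit * (\<tau> s * v s ^ 3)) powr (1/3) = a s / (24 * c_limit * \<tau> s) powr (1/3)"
      using v by simp
  qed
  ultimately show ?thesis by (rule Lim_transform_eventually)
qed

text \<open>The correction of \<open>C\<close> is \<open>- c_limit * v / 4\<close> to first order,
  and \<open>v\<close> is asymptotic to the cube root of
  \<open>c_limit\<^sup>2 / (24 * \<tau>)\<close>. The cube root of 24 contributes another 2 and the
  power \<open>3 powr (1/3)\<close>; the exponent 5/3 is 1 + 2/3.\<close>

lemma c_ratio_tendsto_two:
  "((\<lambda>s. (v s * a s - c_limit) / - (2 powr (-3) * 3 powr (-1/3) * c_limit powr (5/3) * \<tau> s powr (-1/3))) \<longlongrightarrow> 1) at_top"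
proof -
  let ?k = "2 powr (-3) * 3 powr (-1/3) * c_limit powr (5/3) :: real"
  have k: "?k > 0" using c_limit_pos by simp
  have "((\<lambda>s. (v s * a s - c_limit) / v s / - (?k * (\<tau> s * v s ^ 3) powr (-1/3)))
      \<longlongrightarrow> (- c_limit / 4) / - (?k * (c_limit\<^sup>2 / 24) powr (-1/3))) at_top"
    by (intro tendsto_intros c_diff_tendsto \<tau>_v3_tendsto) (use c_limit_pos in auto)
  also have "(- c_limit / 4) / - (?k * (c_limit\<^sup>2 / 24) powr (-1/3)) = 1"
  proof -
    have 24: "(24::real) powr (1/3) = 2 * 3 powr (1/3)"
      using powr_mult[of "2 ^ 3" 3 "1/3 :: real"] cube_powr_third[of 2] by simp
    have "(c_limit\<^sup>2 / 24) powr (-1/3) = (c_limit powr 2) powr (-1/3) / 24 powr (-1/3)"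
      using c_limit_pos by (simp add: powr_divide)
    also have "\<dots> = c_limit powr (-2/3) * (2 * 3 powr (1/3))"
      by (simp add: powr_powr powr_minus_divide 24 del: powr_numeral)
    finally have "?k * (c_limit\<^sup>2 / 24) powr (-1/3)
       = (2 powr (-3) * 2) * (3 powr (-1/3) * 3 powr (1/3)) * (c_limit powr (5/3) * c_limit powr (-2/3))"
      by (simp add: mult_ac)
    also have "\<dots> = 1/4 * 1 * c_limit"
      unfolding powr_add[symmetric] using c_limit_pos by (simp add: powr_minus_divide)
    finally show ?thesis using c_limit_pos by simp
  qed
  finally have "((\<lambda>s. (v s * a s - c_limit) / v s / - (?k * (\<tau> s * v s ^ 3) powr (-1/3))) \<longlongrightarrow> 1) at_top" .
  moreover have "\<forall>\<^sub>F s in at_top. (v s * a s - c_limit) / v s / - (?k * (\<tau> s * v s ^ 3) powr (-1/3))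
      = (v s * a s - c_limit) / - (?k * \<tau> s powr (-1/3))"
    using eventually_ge_at_top[of 0] filterlim_at_top_dense[THEN iffD1, rule_format, OF \<tau>_at_top_two, of 0]
  proof eventually_elim
    fix s :: real assume s: "0 \<le> s" "0 < \<tau> s"
    have v: "v s > 0" using v_pos[OF s(1)] .
    then have "(v s ^ 3) powr (-1/3) = 1 / v s" by (simp add: powr_minus_divide cube_powr_third)
    then have "(\<tau> s * v s ^ 3) powr (-1/3) = \<tau> s powr (-1/3) * (1 / v s)"
      using s v by (subst powr_mult) auto
    then show "(v s * a s - c_limit) / v s / - (?k * (\<tau> s * v s ^ 3) powr (-1/3))
        = (v s * a s - c_limit) / - (?k * \<tau> s powr (-1/3))"
      using v by simp
  qed
  ultimately show ?thesis by (rule Lim_transform_eventually)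
qed

lemma maximal_solution_two:
  obtains A B C where "maximal_diag_xcf_solution A0 B0 C0 \<infinity> A B C" "(C \<longlongrightarrow> c_limit) at_top"
    "\<forall>t\<ge>0. A t = B t" "A \<sim>[at_top] (\<lambda>t. (24 * c_limit * t) powr (1/3))"
    "(\<lambda>t. C t - c_limit) \<sim>[at_top]
       (\<lambda>t. - (2 powr (-3) * 3 powr (-1/3) * c_limit powr (5/3) * t powr (-1/3)))"
proof -
  have "((\<lambda>s. ereal (\<tau> s)) \<longlongrightarrow> \<infinity>) at_top"
    using \<tau>_at_top_two by (simp add: tendsto_PInfty_eq_at_top)
  then obtain \<sigma> where \<sigma>: "\<forall>s\<ge>0. \<tau> s \<in> time_interval \<infinity> \<and> \<sigma> (\<tau> s) = s"
    "\<forall>t\<in>time_interval \<infinity>. \<sigma> t \<ge> 0 \<and> \<tau> (\<sigma> t) = t"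
    "\<forall>s t. 0 \<le> s \<and> t \<in> time_interval \<infinity> \<and> \<tau> s \<le> t \<longrightarrow> s \<le> \<sigma> t"
    and sol: "diag_xcf_solution A0 B0 C0 \<infinity> (\<lambda>t. a (\<sigma> t)) (\<lambda>t. u (\<sigma> t) * a (\<sigma> t)) (\<lambda>t. v (\<sigma> t) * a (\<sigma> t))"
    by (rule diag_xcf_solution_reparametrized)
  have \<sigma>t: "\<sigma> t \<ge> 0" "\<tau> (\<sigma> t) = t" if "t \<ge> 0" for t
    using \<sigma>(2) that by (auto simp: time_interval_def)
  have lim: "filterlim \<sigma> at_top at_top"
    unfolding filterlim_at_top
  proof
    fix Z :: real
    show "\<forall>\<^sub>F t in at_top. Z \<le> \<sigma> t"
      using eventually_ge_at_top[of "max 0 (\<tau> (max 0 Z))"]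
      by eventually_elim (use \<sigma>(3)[rule_format, of "max 0 Z"] in \<open>auto simp: time_interval_def\<close>)
  qed
  have ev: "\<forall>\<^sub>F t in at_top. \<tau> (\<sigma> t) = t"
    using eventually_ge_at_top[of 0] by eventually_elim (rule \<sigma>t)
  show thesis
  proof (rule that[of "\<lambda>t. a (\<sigma> t)" "\<lambda>t. u (\<sigma> t) * a (\<sigma> t)" "\<lambda>t. v (\<sigma> t) * a (\<sigma> t)"])
    show "maximal_diag_xcf_solution A0 B0 C0 \<infinity> (\<lambda>t. a (\<sigma> t)) (\<lambda>t. u (\<sigma> t) * a (\<sigma> t)) (\<lambda>t. v (\<sigma> t) * a (\<sigma> t))"
      by (rule maximal_diag_xcf_solution_infinite[OF sol])
    show "((\<lambda>t. v (\<sigma> t) * a (\<sigma> t)) \<longlongrightarrow> c_limit) at_top"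
      by (rule filterlim_compose[OF c_tendsto lim])
    show "\<forall>t\<ge>0. a (\<sigma> t) = u (\<sigma> t) * a (\<sigma> t)"
      using u_eq_1[OF two(1) \<sigma>t(1)] by simp
    show "(\<lambda>t. a (\<sigma> t)) \<sim>[at_top] (\<lambda>t. (24 * c_limit * t) powr (1/3))"
      by (rule asymp_equivI', rule Lim_transform_eventually[OF filterlim_compose[OF a_ratio_tendsto_two lim]])
        (use ev in \<open>auto elim!: eventually_mono\<close>)
    show "(\<lambda>t. v (\<sigma> t) * a (\<sigma> t) - c_limit) \<sim>[at_top]
       (\<lambda>t. - (2 powr (-3) * 3 powr (-1/3) * c_limit powr (5/3) * t powr (-1/3)))"
      by (rule asymp_equivI', rule Lim_transform_eventually[OF filterlim_compose[OF c_ratio_tendsto_two lim]])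
        (use ev in \<open>auto elim!: eventually_mono\<close>)
  qed
qed

end

end

section \<open>Limits under exponential bounds\<close>

lemma converges_of_exp_bound:
  fixes f g :: "real \<Rightarrow> real"
  assumes "\<kappa> > 0" "s0 \<ge> 0" and d: "\<And>s. s \<ge> s0 \<Longrightarrow> (f has_real_derivative g s) (at s within {0..})"
    and b: "\<And>s. s \<ge> s0 \<Longrightarrow> \<bar>g s\<bar> \<le> M * exp (- \<kappa> * s)"
  obtains l where "(f \<longlongrightarrow> l) at_top"
proof -
  have M: "M \<ge> 0"
    using b[of s0] by (metis abs_ge_zero exp_gt_zero order.refl order_trans zero_le_mult_iff not_less)
  \<comment> \<open>Adding an antiderivative of the bound on \<open>g\<close> makes \<open>h\<close>
    nondecreasing. The mirrored argument for \<open>- f\<close> bounds it above, so its limit is a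
    supremum.\<close>
  define h where "h s = f s - (M / \<kappa>) * exp (- \<kappa> * s)" for s
  have dh: "(h has_real_derivative g s + M * exp (- \<kappa> * s)) (at s within {0..})"
    and dk: "((\<lambda>s. - f s - (M / \<kappa>) * exp (- \<kappa> * s)) has_real_derivative - g s + M * exp (- \<kappa> * s)) (at s within {0..})"
    if "s \<ge> s0" for s
    unfolding h_def[abs_def] using d[OF that] \<open>\<kappa> > 0\<close> by (auto intro!: derivative_eq_intros)
  have mono: "h x \<le> h y" if "s0 \<le> x" "x \<le> y" for x y
  proof (rule mono_within_interval[OF that(2), of "{0..}"])
    show "(h has_real_derivative g s + M * exp (- \<kappa> * s)) (at s within {0..})" if "s \<in> {x..y}" for s
      using dh[of s] that \<open>s0 \<le> x\<close> by simp
    show "0 \<le> g s + M * exp (- \<kappa> * s)" if "s \<in> {x..y}" for s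
      using b[of s] that \<open>s0 \<le> x\<close> by (simp add: abs_le_iff)
  qed (use that \<open>s0 \<ge> 0\<close> in auto)
  have bdd: "h x \<le> f s0 + (M / \<kappa>) * exp (- \<kappa> * s0)" if "s0 \<le> x" for x
  proof -
    have "- f s0 - (M / \<kappa>) * exp (- \<kappa> * s0) \<le> - f x - (M / \<kappa>) * exp (- \<kappa> * x)"
    proof (rule mono_within_interval[OF that, of "{0..}"])
      show "((\<lambda>s. - f s - (M / \<kappa>) * exp (- \<kappa> * s)) has_real_derivative - g s + M * exp (- \<kappa> * s)) (at s within {0..})"
        if "s \<in> {s0..x}" for s using dk[of s] that by simp
      show "0 \<le> - g s + M * exp (- \<kappa> * s)" if "s \<in> {s0..x}" for s
        using b[of s] that by (simp add: abs_le_iff)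
    qed (use \<open>s0 \<ge> 0\<close> in auto)
    moreover have "(M / \<kappa>) * exp (- \<kappa> * x) \<ge> 0" using M \<open>\<kappa> > 0\<close> by simp
    ultimately show ?thesis unfolding h_def by linarith
  qed
  define l where "l = (SUP x\<in>{s0..}. h x)"
  have bA: "bdd_above (h ` {s0..})" using bdd by (auto intro!: bdd_aboveI2)
  have "(h \<longlongrightarrow> l) at_top"
  proof (rule order_tendstoI)
    fix y assume "y < l"
    then obtain x where x: "x \<ge> s0" "y < h x" unfolding l_def using less_cSUP_iff[OF _ bA] by auto
    show "\<forall>\<^sub>F s in at_top. y < h s"
      using eventually_ge_at_top[of x] by eventually_elim (use x mono[of x] in force)
  next
    fix y assume "l < y"
    show "\<forall>\<^sub>F s in at_top. h s < y"
      using eventually_ge_at_top[of s0]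
      by eventually_elim (use cSUP_upper[OF _ bA] \<open>l < y\<close> in \<open>force simp: l_def\<close>)
  qed
  moreover have "((\<lambda>s. exp (- \<kappa> * s)) \<longlongrightarrow> 0) at_top"
    by (rule filterlim_compose[OF exp_at_bot])
      (use \<open>\<kappa> > 0\<close> in \<open>auto simp: filterlim_uminus_at_bot intro!: filterlim_tendsto_pos_mult_at_top[OF tendsto_const] filterlim_ident\<close>)
  ultimately have "((\<lambda>s. h s + (M / \<kappa>) * exp (- \<kappa> * s)) \<longlongrightarrow> l + (M / \<kappa>) * 0) at_top"
    by (intro tendsto_intros)
  then show thesis by (intro that[of l]) (simp add: h_def)
qed

text \<open>
  L'Hopital's rule for the quotient of \<open>l - f\<close> and \<open>exp (- c s)\<close>; at \<open>at_top\<close> the library has the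
  rule only for a denominator tending to infinity.
\<close>

lemma exp_tail_limit:
  fixes f g :: "real \<Rightarrow> real"
  assumes "c > 0" and d: "\<And>s. s \<ge> 0 \<Longrightarrow> (f has_real_derivative g s) (at s within {0..})"
    and g: "((\<lambda>s. g s * exp (c * s)) \<longlongrightarrow> k) at_top" and l: "(f \<longlongrightarrow> l) at_top"
  shows "((\<lambda>s. (l - f s) * exp (c * s)) \<longlongrightarrow> k / c) at_top"
proof -
  have ev: "((\<lambda>s. exp (- (c * s))) \<longlongrightarrow> 0) at_top"
    by (rule filterlim_compose[OF exp_at_bot])
      (use \<open>c > 0\<close> in \<open>auto simp: filterlim_uminus_at_bot intro!: filterlim_tendsto_pos_mult_at_top[OF tendsto_const] filterlim_ident\<close>)
  \<comment> \<open>Stated for arbitrary data, since the lower estimate is the same claim for the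
    negated functions and limits.\<close>
  have up: "(\<forall>\<^sub>F s in at_top. (l - f s) * exp (c * s) \<le> y / c)"
    if d: "\<And>s. s \<ge> 0 \<Longrightarrow> (f has_real_derivative g s) (at s within {0..})"
      and g: "((\<lambda>s. g s * exp (c * s)) \<longlongrightarrow> k) at_top" and l: "(f \<longlongrightarrow> l) at_top" and "k < y"
    for y f g k l
  proof -
    obtain s0 where s0: "s0 \<ge> 0" "\<And>s. s \<ge> s0 \<Longrightarrow> g s * exp (c * s) < y"
      using order_tendstoD(2)[OF g \<open>k < y\<close>] eventually_ge_at_top[of 0]
      unfolding eventually_at_top_linorder by (metis linorder_le_cases order_trans)
    show ?thesis
      using eventually_ge_at_top[of s0]
    proof eventually_elim
      fix s assume s: "s0 \<le> s"
      \<comment> \<open>Once \<open>g\<close> lies below \<open>y * exp (- (c * x))\<close>, this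
        sum is nonincreasing; letting \<open>x\<close> tend to infinity bounds the tail.\<close>
      have le: "f x + (y / c) * exp (- (c * x)) \<le> f s + (y / c) * exp (- (c * s))" if "s \<le> x" for x
      proof -
        have "- (f s + (y / c) * exp (- (c * s))) \<le> - (f x + (y / c) * exp (- (c * x)))"
        proof (rule mono_within_interval[OF that, of "{0..}"])
          show "((\<lambda>x. - (f x + (y / c) * exp (- (c * x)))) has_real_derivative y * exp (- (c * r)) - g r) (at r within {0..})"
            if "r \<in> {s..x}" for r
            using d[of r] that s s0(1) \<open>c > 0\<close> by (auto intro!: derivative_eq_intros)
          show "0 \<le> y * exp (- (c * r)) - g r" if "r \<in> {s..x}" for r
            using s0(2)[of r] that s by (simp add: exp_minus field_simps)
        qed (use s s0 in auto)
        then show ?thesis by simp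
      qed
      have "\<forall>\<^sub>F x in at_top. f x + (y / c) * exp (- (c * x)) \<le> f s + (y / c) * exp (- (c * s))"
        using eventually_ge_at_top[of s] by (rule eventually_mono) (rule le)
      moreover have "((\<lambda>x. f x + (y / c) * exp (- (c * x))) \<longlongrightarrow> l + (y / c) * 0) at_top"
        by (intro tendsto_intros l ev)
      ultimately have "l + (y / c) * 0 \<le> f s + (y / c) * exp (- (c * s))"
        by (intro tendsto_upperbound) auto
      then have "l - f s \<le> (y / c) * exp (- (c * s))" by simp
      from mult_right_mono[OF this, of "exp (c * s)"]
      show "(l - f s) * exp (c * s) \<le> y / c" by (simp add: mult.assoc flip: exp_add)
    qed
  qed
  show ?thesis
  proof (rule order_tendstoI)
    fix y assume "k / c < y"
    then have y: "k < c * y" using \<open>c > 0\<close> by (simp add: field_simps)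
    \<comment> \<open>\<open>up\<close> yields a weak inequality only; an intermediate
      \<open>z\<close> makes it strict.\<close>
    then obtain z where z: "k < z" "z < c * y" using dense by blast
    have zy: "z / c < y" using z \<open>c > 0\<close> by (simp add: pos_divide_less_eq mult.commute)
    have "\<forall>\<^sub>F s in at_top. (l - f s) * exp (c * s) \<le> z / c"
      by (rule up[OF _ g l z(1)]) (rule d)
    then show "\<forall>\<^sub>F s in at_top. (l - f s) * exp (c * s) < y"
      by eventually_elim (use zy in simp)
  next
    fix y assume "y < k / c"
    then have y: "c * y < k" using \<open>c > 0\<close> by (simp add: field_simps)
    then obtain z where z: "c * y < z" "z < k" using dense by blast
    have g': "((\<lambda>s. - g s * exp (c * s)) \<longlongrightarrow> - k) at_top" using tendsto_minus[OF g] by simp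
    have "\<forall>\<^sub>F s in at_top. (- l - - f s) * exp (c * s) \<le> - z / c"
      by (rule up[OF _ g' tendsto_minus[OF l]]) (use d z in \<open>auto intro: DERIV_minus\<close>)
    then show "\<forall>\<^sub>F s in at_top. y < (l - f s) * exp (c * s)"
    proof eventually_elim
      fix s assume *: "(- l - - f s) * exp (c * s) \<le> - z / c"
      have "y < z / c" using z \<open>c > 0\<close> by (simp add: pos_less_divide_eq mult.commute)
      moreover have "(- l - - f s) * exp (c * s) = - ((l - f s) * exp (c * s))" by (simp add: algebra_simps)
      ultimately show "y < (l - f s) * exp (c * s)" using * by simp
    qed
  qed
qed

lemma asymp_equiv_of_ratio_limit:
  fixes f g :: "real \<Rightarrow> real"
  assumes "((\<lambda>x. f x / g x) \<longlongrightarrow> c) F" "c \<noteq> 0"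
  shows "f \<sim>[F] (\<lambda>x. c * g x)"
proof (rule asymp_equivI')
  have "((\<lambda>x. f x / g x / c) \<longlongrightarrow> c / c) F" by (intro tendsto_intros assms)
  then show "((\<lambda>x. f x / (c * g x)) \<longlongrightarrow> 1) F" using assms(2) by (simp add: field_simps)
qed

text \<open>At the origin \<open>Q = R = -1\<close> and both cofactors equal 1; because
  \<open>v \<le> u\<close>, all errors are controlled by \<open>u\<close> alone. The first bound is
  not local: it drives the decay of \<open>u\<close> from any point of the triangle with
  \<open>0 < u < 1\<close>.\<close>

lemma ratio_near_origin:
  assumes "0 \<le> v" "v \<le> u" "u \<le> 1"
  shows "ratio_R u v \<le> - (1 - u)\<^sup>2" "\<bar>ratio_Q u v + 1\<bar> \<le> 10 * u" "\<bar>ratio_R u v + 1\<bar> \<le> 10 * u"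
    "\<bar>(1 - u) * (1 + u - v) - 1\<bar> \<le> 3 * u" "\<bar>(1 - v) * (1 + v - u) - 1\<bar> \<le> 3 * u"
proof -
  have "v * (3 * v - 2 - 2 * u) \<le> 0" using assms by (intro mult_nonneg_nonpos) auto
  then show "ratio_R u v \<le> - (1 - u)\<^sup>2" by (simp add: ratio_R_def power2_eq_square algebra_simps)
  have *: "0 \<le> u\<^sup>2" "u\<^sup>2 \<le> u" "0 \<le> v\<^sup>2" "v\<^sup>2 \<le> v" "0 \<le> u * v" "u * v \<le> v"
    using assms by (auto simp: power2_eq_square mult_left_le mult_left_le_one_le)
  have e: "ratio_Q u v + 1 = 3 * u\<^sup>2 + 2 * v - v\<^sup>2 - 2 * u - 2 * (u * v)"
    "ratio_R u v + 1 = 3 * v\<^sup>2 + 2 * u - u\<^sup>2 - 2 * v - 2 * (u * v)"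
    "(1 - u) * (1 + u - v) - 1 = u * v - v - u\<^sup>2" "(1 - v) * (1 + v - u) - 1 = u * v - u - v\<^sup>2"
    by (simp_all add: ratio_Q_def ratio_R_def power2_eq_square algebra_simps)
  show "\<bar>ratio_Q u v + 1\<bar> \<le> 10 * u" "\<bar>ratio_R u v + 1\<bar> \<le> 10 * u"
    "\<bar>(1 - u) * (1 + u - v) - 1\<bar> \<le> 3 * u" "\<bar>(1 - v) * (1 + v - u) - 1\<bar> \<le> 3 * u"
    unfolding e abs_le_iff using * assms by linarith+
qed

lemma abs_mult_plus_1_le:
  fixes w r :: real
  assumes "\<bar>w - 1\<bar> \<le> 3 * u" "\<bar>r + 1\<bar> \<le> 10 * u" "\<bar>r\<bar> \<le> 5"
  shows "\<bar>w * r + 1\<bar> \<le> 25 * u"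
proof -
  have "\<bar>w - 1\<bar> * \<bar>r\<bar> \<le> (3 * u) * 5" using assms by (intro mult_mono) auto
  moreover have "w * r + 1 = (w - 1) * r + (r + 1)" by algebra
  ultimately show ?thesis using assms(2) abs_triangle_ineq[of "(w - 1) * r" "r + 1"] by (simp add: abs_mult)
qed

context xcf_parametrization
begin

section \<open>The case \<open>A > B\<close>\<close>

context
  assumes three: "B0 < A0"
begin

lemma u0_less_1: "u 0 < 1"
  using u_less_1[OF three, of 0] by simp

text \<open>The equation gives \<open>u' \<le> - 4 * u * (1 - u) ^ 3\<close>, and
  \<open>1 - u\<close> only grows. The rate is not sharp, but it makes \<open>u\<close> integrable,
  which is all that the sharp rates require.\<close>

lemma u_exp_bound:
  assumes s: "s \<ge> 0"
  shows "u s \<le> exp (- (4 * (1 - u 0) ^ 3) * s)"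
proof -
  have R: "ratio_R (u x) (v x) \<le> - (1 - u x)\<^sup>2" if "x \<ge> 0" for x
    using ratio_near_origin(1) v_pos[OF that] v_le_u[OF that] u_le_1[OF that] by simp
  have du': "(u has_real_derivative 4 * u x * ((1 - u x) * ((1 + u x - v x) * ratio_R (u x) (v x)))) (at x within {0..})"
    if "x \<ge> 0" for x
    using du[OF that] unfolding ratio_factor by (simp only: mult_ac)
  have neg: "(1 + u x - v x) * ratio_R (u x) (v x) \<le> - (1 - u x)\<^sup>2" if "x \<ge> 0" for x
  proof -
    have "(u x - v x) * ratio_R (u x) (v x) \<le> 0"
      using R[OF that] v_le_u[OF that] by (intro mult_nonneg_nonpos) (auto intro: order_trans)
    then show ?thesis using R[OF that] by (simp add: algebra_simps)
  qed
  have le: "(1 - u x) * ((1 + u x - v x) * ratio_R (u x) (v x)) \<le> - ((1 - u x) ^ 3)" if "x \<ge> 0" for x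
    using mult_left_mono[OF neg[OF that], of "1 - u x"] u_le_1[OF that] by (simp add: power2_eq_square power3_eq_cube)
  have u_le: "u x \<le> u 0" if "x \<ge> 0" for x
  proof -
    have "- u 0 \<le> - u x"
    proof (rule mono_within_interval[OF that, of "{0..}"])
      fix y assume y: "y \<in> {0..x}"
      show "((\<lambda>y. - u y) has_real_derivative - (4 * u y * ((1 - u y) * ((1 + u y - v y) * ratio_R (u y) (v y))))) (at y within {0..})"
        by (rule DERIV_minus[OF du']) (use y in simp)
      have "(1 - u y) * ((1 + u y - v y) * ratio_R (u y) (v y)) \<le> 0"
        using le[of y] u_le_1[of y] y by (smt (verit) atLeastAtMost_iff zero_le_power)
      then show "0 \<le> - (4 * u y * ((1 - u y) * ((1 + u y - v y) * ratio_R (u y) (v y))))"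
        using u_pos[of y] y by (auto simp: mult_le_0_iff)
    qed auto
    then show ?thesis by simp
  qed
  have "u s \<le> u 0 * exp (- (4 * (1 - u 0) ^ 3) * s)"
  proof (rule gronwall_upper[OF s, of "{0..}"])
    fix x assume x: "x \<in> {0..s}"
    show "(u has_real_derivative 4 * u x * ((1 - u x) * ((1 + u x - v x) * ratio_R (u x) (v x)))) (at x within {0..})"
      using du' x by simp
    have "(1 - u 0) ^ 3 \<le> (1 - u x) ^ 3" using u_le[of x] x u0_less_1 by (intro power_mono) auto
    then have "(1 - u x) * ((1 + u x - v x) * ratio_R (u x) (v x)) \<le> - ((1 - u 0) ^ 3)" using le[of x] x by simp
    from mult_left_mono[OF this, of "4 * u x"] u_pos[of x] x
    show "4 * u x * ((1 - u x) * ((1 + u x - v x) * ratio_R (u x) (v x))) \<le> - (4 * (1 - u 0) ^ 3) * u x"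
      by (simp add: mult_ac)
  qed auto
  also have "\<dots> \<le> 1 * exp (- (4 * (1 - u 0) ^ 3) * s)" using u0_less_1 by (intro mult_right_mono) auto
  finally show ?thesis by simp
qed

text \<open>Each logarithmic derivative is a constant plus an error of size at most
  \<open>100 * u\<close>. Since \<open>u\<close> is integrable, the logarithm minus its linear part
  converges, and exponentiating yields a limit that is automatically positive.\<close>

lemma exp_rates:
  obtains p q r where "p > 0" "q > 0" "r > 0" "((\<lambda>s. u s * exp (4 * s)) \<longlongrightarrow> p) at_top"
    "((\<lambda>s. v s * exp (4 * s)) \<longlongrightarrow> q) at_top" "((\<lambda>s. a s * exp (- s)) \<longlongrightarrow> r) at_top"
proof -
  let ?\<kappa> = "4 * (1 - u 0) ^ 3"
  have \<kappa>: "?\<kappa> > 0" using u0_less_1 by simp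
  have b: "\<bar>ratio_Q (u s) (v s) + 1\<bar> \<le> 10 * u s" "\<bar>ratio_R (u s) (v s) + 1\<bar> \<le> 10 * u s"
    "\<bar>(1 - u s) * (1 + u s - v s) - 1\<bar> \<le> 3 * u s" "\<bar>(1 - v s) * (1 + v s - u s) - 1\<bar> \<le> 3 * u s"
    "\<bar>ratio_Q (u s) (v s)\<bar> \<le> 5" "\<bar>ratio_R (u s) (v s)\<bar> \<le> 5"
    if "s \<ge> 0" for s
    using ratio_near_origin[of "v s" "u s"] ratio_bounds[of "u s" "v s"] v_pos[OF that] v_le_u[OF that] u_le_1[OF that]
    by auto
  have log_limit: "\<exists>l>0. ((\<lambda>s. f s * exp (c * s)) \<longlongrightarrow> l) at_top"
    if pos: "\<And>s. s \<ge> 0 \<Longrightarrow> f s > 0" and d: "\<And>s. s \<ge> 0 \<Longrightarrow> (f has_real_derivative f s * (g s - c)) (at s within {0..})"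
      and g: "\<And>s. s \<ge> 0 \<Longrightarrow> \<bar>g s\<bar> \<le> 100 * u s" for f g :: "real \<Rightarrow> real" and c
  proof -
    have dl: "((\<lambda>s. ln (f s) + c * s) has_real_derivative g s) (at s within {0..})" if "s \<ge> 0" for s
      using d[OF that] pos[OF that] by (auto intro!: derivative_eq_intros simp: field_simps)
    have "\<bar>g s\<bar> \<le> 100 * exp (- ?\<kappa> * s)" if "s \<ge> 0" for s
      using g[OF that] u_exp_bound[OF that] by linarith
    from converges_of_exp_bound[OF \<kappa> order.refl dl this]
    obtain l where "((\<lambda>s. ln (f s) + c * s) \<longlongrightarrow> l) at_top" by blast
    then have "((\<lambda>s. exp (ln (f s) + c * s)) \<longlongrightarrow> exp l) at_top" by (rule tendsto_exp)
    moreover have "\<forall>\<^sub>F s in at_top. exp (ln (f s) + c * s) = f s * exp (c * s)"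
      using eventually_ge_at_top[of 0] by eventually_elim (simp add: exp_add pos)
    ultimately have "((\<lambda>s. f s * exp (c * s)) \<longlongrightarrow> exp l) at_top" by (rule Lim_transform_eventually)
    then show ?thesis by (intro exI[of _ "exp l"]) simp
  qed
  have "\<exists>l>0. ((\<lambda>s. u s * exp (4 * s)) \<longlongrightarrow> l) at_top"
  proof (rule log_limit[where g = "\<lambda>s. 4 * ((1 - u s) * (1 + u s - v s) * ratio_R (u s) (v s) + 1)"])
    fix s :: real assume s: "s \<ge> 0"
    show "(u has_real_derivative u s * (4 * ((1 - u s) * (1 + u s - v s) * ratio_R (u s) (v s) + 1) - 4)) (at s within {0..})"
      using du[OF s] unfolding ratio_factor by (simp add: algebra_simps)
    show "\<bar>4 * ((1 - u s) * (1 + u s - v s) * ratio_R (u s) (v s) + 1)\<bar> \<le> 100 * u s"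
      using abs_mult_plus_1_le[OF b(3)[OF s] b(2)[OF s] b(6)[OF s]] unfolding abs_mult by simp
  qed (rule u_pos)
  moreover have "\<exists>l>0. ((\<lambda>s. v s * exp (4 * s)) \<longlongrightarrow> l) at_top"
  proof (rule log_limit[where g = "\<lambda>s. 4 * ((1 - v s) * (1 + v s - u s) * ratio_Q (u s) (v s) + 1)"])
    fix s :: real assume s: "s \<ge> 0"
    show "(v has_real_derivative v s * (4 * ((1 - v s) * (1 + v s - u s) * ratio_Q (u s) (v s) + 1) - 4)) (at s within {0..})"
      using dv[OF s] unfolding ratio_factor by (simp add: algebra_simps)
    show "\<bar>4 * ((1 - v s) * (1 + v s - u s) * ratio_Q (u s) (v s) + 1)\<bar> \<le> 100 * u s"
      using abs_mult_plus_1_le[OF b(4)[OF s] b(1)[OF s] b(5)[OF s]] unfolding abs_mult by simp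
  qed (rule v_pos)
  moreover have "\<exists>l>0. ((\<lambda>s. a s * exp (-1 * s)) \<longlongrightarrow> l) at_top"
  proof (rule log_limit[where g = "\<lambda>s. ratio_Q (u s) (v s) * ratio_R (u s) (v s) - 1"])
    fix s :: real assume s: "s \<ge> 0"
    show "(a has_real_derivative a s * (ratio_Q (u s) (v s) * ratio_R (u s) (v s) - 1 - -1)) (at s within {0..})"
      using da[OF s] by simp
    have "\<bar>ratio_Q (u s) (v s) + 1\<bar> * \<bar>ratio_R (u s) (v s)\<bar> \<le> (10 * u s) * 5"
      using b[OF s] by (intro mult_mono) auto
    moreover have "ratio_Q (u s) (v s) * ratio_R (u s) (v s) - 1
        = (ratio_Q (u s) (v s) + 1) * ratio_R (u s) (v s) - (ratio_R (u s) (v s) + 1)" by algebra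
    ultimately show "\<bar>ratio_Q (u s) (v s) * ratio_R (u s) (v s) - 1\<bar> \<le> 100 * u s"
      using b(2)[OF s] u_pos[OF s]
        abs_triangle_ineq4[of "(ratio_Q (u s) (v s) + 1) * ratio_R (u s) (v s)" "ratio_R (u s) (v s) + 1"]
      unfolding abs_mult by linarith
  qed (rule a_pos)
  ultimately show thesis using that by auto
qed

lemma maximal_solution_three:
  obtains \<theta> A B C \<eta>1 \<eta>2 \<eta>3 where "maximal_diag_xcf_solution A0 B0 C0 (ereal \<theta>) A B C" "\<theta> > 0"
    "\<eta>1 > 0" "\<eta>2 > 0" "\<eta>3 > 0"
    "A \<sim>[at_left \<theta>] (\<lambda>t. \<eta>1 * (\<theta> - t) powr (-1/14))"
    "B \<sim>[at_left \<theta>] (\<lambda>t. \<eta>2 * (\<theta> - t) powr (3/14))"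
    "C \<sim>[at_left \<theta>] (\<lambda>t. \<eta>3 * (\<theta> - t) powr (3/14))"
proof -
  obtain p q r where pqr: "p > 0" "q > 0" "r > 0" and U: "((\<lambda>s. u s * exp (4 * s)) \<longlongrightarrow> p) at_top"
    and V: "((\<lambda>s. v s * exp (4 * s)) \<longlongrightarrow> q) at_top" and A: "((\<lambda>s. a s * exp (- s)) \<longlongrightarrow> r) at_top"
    by (rule exp_rates)
  define g where "g s = (a s)\<^sup>2 * (u s)\<^sup>2 * (v s)\<^sup>2 / 2" for s
  define k where "k = r\<^sup>2 * p\<^sup>2 * q\<^sup>2 / 2"
  have k: "k > 0" using pqr by (simp add: k_def)
  have G: "((\<lambda>s. g s * exp (14 * s)) \<longlongrightarrow> k) at_top"
  proof -
    have "((\<lambda>s. (a s * exp (- s))\<^sup>2 * (u s * exp (4 * s))\<^sup>2 * (v s * exp (4 * s))\<^sup>2 / 2) \<longlongrightarrow> k) at_top"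
      unfolding k_def by (intro tendsto_intros A U V) auto
    moreover have "(a s * exp (- s))\<^sup>2 * (u s * exp (4 * s))\<^sup>2 * (v s * exp (4 * s))\<^sup>2 / 2 = g s * exp (14 * s)" for s
    proof -
      have "exp (14 * s) = (exp (- s))\<^sup>2 * (exp (4 * s))\<^sup>2 * (exp (4 * s))\<^sup>2"
        by (simp add: power2_eq_square flip: exp_add)
      then show ?thesis by (simp add: g_def power_mult_distrib)
    qed
    ultimately show ?thesis by simp
  qed
  have d\<tau>': "(\<tau> has_real_derivative g s) (at s within {0..})" if "s \<ge> 0" for s
    using d\<tau>[OF that] by (simp add: g_def)
  have gpos: "g s > 0" if "s \<ge> 0" for s
    using a_pos[OF that] u_pos[OF that] v_pos[OF that] by (simp add: g_def)
  \<comment> \<open>Any number above \<open>k\<close> serves as an eventual bound; it forces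
    \<open>\<tau>\<close> to converge, so the lifetime is finite.\<close>
  obtain s0 where s0: "s0 \<ge> 0" "\<And>s. s \<ge> s0 \<Longrightarrow> g s * exp (14 * s) < k + 1"
    using order_tendstoD(2)[OF G, of "k + 1"] eventually_ge_at_top[of 0]
    unfolding eventually_at_top_linorder by (metis linorder_le_cases order_trans less_add_one)
  have gb: "\<bar>g s\<bar> \<le> (k + 1) * exp (- 14 * s)" if "s \<ge> s0" for s
    using s0(2)[OF that] gpos[of s] s0(1) that by (simp add: exp_minus field_simps)
  obtain \<theta> where \<theta>: "(\<tau> \<longlongrightarrow> \<theta>) at_top"
    by (rule converges_of_exp_bound[of 14 s0 \<tau> g "k + 1"]) (use s0 gb d\<tau>' in auto)
  define m where "m = k / 14"
  have m: "m > 0" using k by (simp add: m_def)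
  have tail: "((\<lambda>s. (\<theta> - \<tau> s) * exp (14 * s)) \<longlongrightarrow> m) at_top"
    unfolding m_def by (rule exp_tail_limit[OF _ d\<tau>' G \<theta>]) auto
  have "((\<lambda>s. ereal (\<tau> s)) \<longlongrightarrow> ereal \<theta>) at_top" using \<theta> by simp
  then obtain \<sigma> where \<sigma>: "\<forall>s\<ge>0. \<tau> s \<in> time_interval (ereal \<theta>) \<and> \<sigma> (\<tau> s) = s"
    "\<forall>t\<in>time_interval (ereal \<theta>). \<sigma> t \<ge> 0 \<and> \<tau> (\<sigma> t) = t"
    "\<forall>s t. 0 \<le> s \<and> t \<in> time_interval (ereal \<theta>) \<and> \<tau> s \<le> t \<longrightarrow> s \<le> \<sigma> t"
    and sol: "diag_xcf_solution A0 B0 C0 (ereal \<theta>) (\<lambda>t. a (\<sigma> t)) (\<lambda>t. u (\<sigma> t) * a (\<sigma> t)) (\<lambda>t. v (\<sigma> t) * a (\<sigma> t))"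
    by (rule diag_xcf_solution_reparametrized)
  have \<theta>0: "\<theta> > 0" using sol by (simp add: diag_xcf_solution_def)
  have mem: "0 \<le> \<tau> s" "\<tau> s < \<theta>" if "s \<ge> 0" for s
    using \<sigma>(1) that by (auto simp: time_interval_def)
  have lim: "filterlim \<sigma> at_top (at_left \<theta>)"
    unfolding filterlim_at_top
  proof
    fix Z :: real
    show "\<forall>\<^sub>F t in at_left \<theta>. Z \<le> \<sigma> t"
      using eventually_at_left_real[OF mem(2)[OF max.cobounded1[of 0 Z]]]
    proof eventually_elim
      fix t assume t: "t \<in> {\<tau> (max 0 Z)<..<\<theta>}"
      then have "t \<in> time_interval (ereal \<theta>)" using mem(1)[of "max 0 Z"] by (simp add: time_interval_def)
      then show "Z \<le> \<sigma> t" using \<sigma>(3)[rule_format, of "max 0 Z" t] t by simp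
    qed
  qed
  have ev: "\<forall>\<^sub>F t in at_left \<theta>. \<tau> (\<sigma> t) = t"
    using eventually_at_left_real[OF \<theta>0] by eventually_elim (use \<sigma>(2) in \<open>auto simp: time_interval_def\<close>)
  \<comment> \<open>Both \<open>f\<close> and \<open>\<theta> - \<tau>\<close> are measured against
    \<open>exp (- (14 * s))\<close>; eliminating the exponential leaves the power \<open>e\<close>
    and the constant \<open>l' / m powr e\<close>.\<close>
  have transfer: "(\<lambda>t. f (\<sigma> t)) \<sim>[at_left \<theta>] (\<lambda>t. l * (\<theta> - t) powr e)"
    if f: "((\<lambda>s. f s * exp (14 * e * s)) \<longlongrightarrow> l') at_top" and l: "l = l' / m powr e" "l' > 0" for f l l' e
  proof (rule asymp_equiv_of_ratio_limit)
    have "((\<lambda>s. f s * exp (14 * e * s) / ((\<theta> - \<tau> s) * exp (14 * s)) powr e) \<longlongrightarrow> l) at_top"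
      unfolding l(1) by (intro tendsto_intros f tail) (use m in auto)
    moreover have "\<forall>\<^sub>F s in at_top. f s * exp (14 * e * s) / ((\<theta> - \<tau> s) * exp (14 * s)) powr e = f s / (\<theta> - \<tau> s) powr e"
      using eventually_ge_at_top[of 0]
    proof eventually_elim
      fix s :: real assume "0 \<le> s"
      then have "\<theta> - \<tau> s > 0" using mem(2)[of s] by simp
      then have "((\<theta> - \<tau> s) * exp (14 * s)) powr e = (\<theta> - \<tau> s) powr e * exp (14 * s) powr e"
        by (simp add: powr_mult)
      also have "exp (14 * s) powr e = exp (14 * e * s)" by (simp add: powr_def mult_ac)
      finally show "f s * exp (14 * e * s) / ((\<theta> - \<tau> s) * exp (14 * s)) powr e = f s / (\<theta> - \<tau> s) powr e"
        by simp
    qed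
    ultimately have "((\<lambda>s. f s / (\<theta> - \<tau> s) powr e) \<longlongrightarrow> l) at_top" by (rule Lim_transform_eventually)
    from filterlim_compose[OF this lim]
    show "((\<lambda>t. f (\<sigma> t) / (\<theta> - t) powr e) \<longlongrightarrow> l) (at_left \<theta>)"
      by (rule Lim_transform_eventually) (use ev in \<open>auto elim!: eventually_mono\<close>)
    show "l \<noteq> 0" using l m by simp
  qed
  have blow: "filterlim (\<lambda>t. a (\<sigma> t)) at_top (at_left \<theta>)"
  proof (rule filterlim_compose[OF _ lim])
    have "filterlim (\<lambda>s. (a s * exp (- s)) * exp s) at_top at_top"
      by (rule filterlim_tendsto_pos_mult_at_top[OF A pqr(3) exp_at_top])
    moreover have "(a s * exp (- s)) * exp s = a s" for s by (simp add: exp_minus)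
    ultimately show "filterlim a at_top at_top" by simp
  qed
  \<comment> \<open>The rates combine to -4 + 1 = -3, which matches \<open>14 * e\<close> for
    \<open>e = 3/14\<close>.\<close>
  have prod: "((\<lambda>s. u s * a s * exp (3 * s)) \<longlongrightarrow> p * r) at_top" "((\<lambda>s. v s * a s * exp (3 * s)) \<longlongrightarrow> q * r) at_top"
  proof -
    have e: "exp (3 * s) = exp (4 * s) * exp (- s)" for s :: real by (simp flip: exp_add)
    show "((\<lambda>s. u s * a s * exp (3 * s)) \<longlongrightarrow> p * r) at_top" "((\<lambda>s. v s * a s * exp (3 * s)) \<longlongrightarrow> q * r) at_top"
      unfolding e using tendsto_mult[OF U A] tendsto_mult[OF V A] by (simp_all add: mult_ac)
  qed
  show thesis
  proof (rule that)
    show "maximal_diag_xcf_solution A0 B0 C0 (ereal \<theta>) (\<lambda>t. a (\<sigma> t)) (\<lambda>t. u (\<sigma> t) * a (\<sigma> t)) (\<lambda>t. v (\<sigma> t) * a (\<sigma> t))"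
      by (rule maximal_diag_xcf_solution_blowup[OF sol blow])
    show "(\<lambda>t. a (\<sigma> t)) \<sim>[at_left \<theta>] (\<lambda>t. r / m powr (-1/14) * (\<theta> - t) powr (-1/14))"
      by (rule transfer[where f = a and l' = r]) (use A pqr in simp_all)
    show "(\<lambda>t. u (\<sigma> t) * a (\<sigma> t)) \<sim>[at_left \<theta>] (\<lambda>t. p * r / m powr (3/14) * (\<theta> - t) powr (3/14))"
      by (rule transfer[where f = "\<lambda>s. u s * a s" and l' = "p * r"]) (use prod pqr in simp_all)
    show "(\<lambda>t. v (\<sigma> t) * a (\<sigma> t)) \<sim>[at_left \<theta>] (\<lambda>t. q * r / m powr (3/14) * (\<theta> - t) powr (3/14))"
      by (rule transfer[where f = "\<lambda>s. v s * a s" and l' = "q * r"]) (use prod pqr in simp_all)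
  qed (use \<theta>0 pqr m in simp_all)
qed

end

end

theorem theorem3p8:
  fixes A0 B0 C0 :: real
  assumes "A0 \<ge> B0" and "B0 \<ge> C0" and "C0 > 0"
  shows "\<exists>T A B C. maximal_diag_xcf_solution A0 B0 C0 T A B C \<and>
    (A0 = B0 \<and> B0 = C0 \<longrightarrow>
       T = \<infinity> \<and>
       (\<forall>t\<ge>0. A t = sqrt (A0\<^sup>2 + 4 * t) \<and> B t = sqrt (A0\<^sup>2 + 4 * t) \<and> C t = sqrt (A0\<^sup>2 + 4 * t))) \<and>
    (A0 = B0 \<and> B0 > C0 \<longrightarrow>
       T = \<infinity> \<and>
       (\<exists>Cinf>0. (C \<longlongrightarrow> Cinf) at_top \<and>
          (\<forall>t\<ge>0. A t = B t) \<and>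
          A \<sim>[at_top] (\<lambda>t. (24 * Cinf * t) powr (1/3)) \<and>
          (\<lambda>t. C t - Cinf) \<sim>[at_top]
            (\<lambda>t. - (2 powr (-3) * 3 powr (-1/3) * Cinf powr (5/3) * t powr (-1/3))))) \<and>
    (A0 > B0 \<longrightarrow>
       (\<exists>\<tau>>0. T = ereal \<tau> \<and>
          (\<exists>\<eta>1>0. \<exists>\<eta>2>0. \<exists>\<eta>3>0.
             A \<sim>[at_left \<tau>] (\<lambda>t. \<eta>1 * (\<tau> - t) powr (-1/14)) \<and>
             B \<sim>[at_left \<tau>] (\<lambda>t. \<eta>2 * (\<tau> - t) powr (3/14)) \<and>
             C \<sim>[at_left \<tau>] (\<lambda>t. \<eta>3 * (\<tau> - t) powr (3/14)))))"
proof -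
  \<comment> \<open>The round case bypasses the parametrization: both ratios stay equal to 1, so no
    decay is available.\<close>
  consider (round) "A0 = B0" "B0 = C0" | (two) "A0 = B0" "B0 > C0" | (three) "A0 > B0"
    using assms by linarith
  then show ?thesis
  proof cases
    case round
    let ?w = "\<lambda>t. sqrt (A0\<^sup>2 + 4 * t)"
    have "maximal_diag_xcf_solution A0 B0 C0 \<infinity> ?w ?w ?w"
      using maximal_diag_xcf_solution_infinite[OF diag_xcf_solution_round[of A0]] round assms by simp
    then show ?thesis
      using round by (intro exI[of _ \<infinity>] exI[of _ ?w]) auto
  next
    case two
    obtain u v a \<tau> where "xcf_parametrization A0 B0 C0 u v a \<tau>"
      by (rule xcf_parametrization_exists[OF assms])
    then interpret xcf_parametrization A0 B0 C0 u v a \<tau> .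
    have eq: "B0 = A0" "C0 < A0" using two by auto
    obtain A B C where "maximal_diag_xcf_solution A0 B0 C0 \<infinity> A B C" "(C \<longlongrightarrow> c_limit) at_top"
      "\<forall>t\<ge>0. A t = B t" "A \<sim>[at_top] (\<lambda>t. (24 * c_limit * t) powr (1/3))"
      "(\<lambda>t. C t - c_limit) \<sim>[at_top]
         (\<lambda>t. - (2 powr (-3) * 3 powr (-1/3) * c_limit powr (5/3) * t powr (-1/3)))"
      by (rule maximal_solution_two[OF eq])
    moreover have "c_limit > 0" by (rule c_limit_pos[OF eq])
    ultimately show ?thesis
      using two by (intro exI[of _ \<infinity>] exI[of _ A] exI[of _ B] exI[of _ C]) auto
  next
    case three
    obtain u v a \<tau> where "xcf_parametrization A0 B0 C0 u v a \<tau>"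
      by (rule xcf_parametrization_exists[OF assms])
    then interpret xcf_parametrization A0 B0 C0 u v a \<tau> .
    obtain \<theta> A B C \<eta>1 \<eta>2 \<eta>3 where "maximal_diag_xcf_solution A0 B0 C0 (ereal \<theta>) A B C" "\<theta> > 0"
      "\<eta>1 > 0" "\<eta>2 > 0" "\<eta>3 > 0"
      "A \<sim>[at_left \<theta>] (\<lambda>t. \<eta>1 * (\<theta> - t) powr (-1/14))"
      "B \<sim>[at_left \<theta>] (\<lambda>t. \<eta>2 * (\<theta> - t) powr (3/14))"
      "C \<sim>[at_left \<theta>] (\<lambda>t. \<eta>3 * (\<theta> - t) powr (3/14))"
      by (rule maximal_solution_three[OF three])
    then have "(\<exists>\<tau>>0. ereal \<theta> = ereal \<tau> \<and>
          (\<exists>\<eta>1>0. \<exists>\<eta>2>0. \<exists>\<eta>3>0.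
             A \<sim>[at_left \<tau>] (\<lambda>t. \<eta>1 * (\<tau> - t) powr (-1/14)) \<and>
             B \<sim>[at_left \<tau>] (\<lambda>t. \<eta>2 * (\<tau> - t) powr (3/14)) \<and>
             C \<sim>[at_left \<tau>] (\<lambda>t. \<eta>3 * (\<tau> - t) powr (3/14))))"
      by (intro exI[of _ \<theta>] conjI refl exI[of _ \<eta>1] exI[of _ \<eta>2] exI[of _ \<eta>3])
    with \<open>maximal_diag_xcf_solution A0 B0 C0 (ereal \<theta>) A B C\<close> show ?thesis
      using three by (intro exI[of _ "ereal \<theta>"] exI[of _ A] exI[of _ B] exI[of _ C]) simp
  qed
qed

end
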